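(* Let $(M,\omega)$ be a compact connected Kähler manifold without boundary, of complex dimension $n$, let $\mathcal{C}$ be the space of volume conformal factors, and let $\chi\in C^\infty(]0,+\infty[,\,]0,+\infty[)$. The geodesic equation $D^\chi_t\frac{dF}{dt}=0$ for a smooth curve $F=F(t)$ in $\mathcal{C}$, with respect to the weighted metric with weight $\chi$, is $$\frac{d^2F}{dt^2}+\frac{\chi'(F)}{2\chi(F)}\left(\frac{dF}{dt}\right)^2-\frac{\chi^{-1}(F)}{\int_M\chi^{-1}(F)\frac{\omega^n}{n!}}\int_M\frac{\chi'(F)}{2\chi(F)}\left(\frac{dF}{dt}\right)^2\frac{\omega^n}{n!}=0 .$$
   Context: The space of volume conformal factors is $\mathcal{C}=\{F\in C^\infty(M,\mathbb{R}): F>0,\ \int_MF\omega^n=\int_M\omega^n\}$, with tangent space $T_F\mathcal{C}=\{G\in C^\infty(M,\mathbb{R}):\int_MG\,\omega^n=0\}$. The weighted metric with weight $\chi$ is $\langle G_1,G_2\rangle_{F;\chi}=\int_M\chi(F)G_1G_2\frac{\omega^n}{n!}$. Here $\chi^{-1}=1/\chi$ is the multiplicative inverse. The Levi-Civita covariant derivative $D^\chi$ of this metric is the unique covariant derivative of smooth vector fields along smooth curves in $\mathcal{C}$ that is additive, satisfies the Leibniz rule, is compatible with the metric ($\frac{d}{dt}\langle G,H\rangle=\langle D^\chi_tG,H\rangle+\langle G,D^\chi_tH\rangle$) and is torsion free ($D^\chi_tF_s=D^\chi_sF_t$ for smooth two-parameter families). *)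

theory Defs
  imports "HOL-Analysis.Analysis"
begin

text \<open>\<open>C_upto k S f\<close> is the class \<open>C\<^sup>k\<close> on the set \<open>S\<close>, which is open in all uses.\<close>

primrec C_upto :: "nat \<Rightarrow> 'a::real_normed_vector set \<Rightarrow> ('a \<Rightarrow> 'b::real_normed_vector) \<Rightarrow> bool" where
  "C_upto 0 S f \<longleftrightarrow> continuous_on S f"
| "C_upto (Suc k) S f \<longleftrightarrow>
     (\<forall>x\<in>S. f differentiable (at x)) \<and> (\<forall>v. C_upto k S (\<lambda>x. frechet_derivative f (at x) v))"

definition C_infty_on :: "'a::real_normed_vector set \<Rightarrow> ('a \<Rightarrow> 'b::real_normed_vector) \<Rightarrow> bool" where
  "C_infty_on S f \<longleftrightarrow> (\<forall>k. C_upto k S f)"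

definition holomorphic_map_on :: "(complex^'n::finite) set \<Rightarrow> (complex^'n \<Rightarrow> complex^'n) \<Rightarrow> bool" where
  "holomorphic_map_on S f \<longleftrightarrow>
     (\<forall>z\<in>S. \<exists>f'. (f has_derivative f') (at z) \<and> (\<forall>c v. f' (c *s v) = c *s f' v))"

text \<open>The underlying space of the manifold is the whole type \<open>'a\<close>. A chart is a pair of a domain
  and a coordinate map.\<close>

type_synonym ('a, 'n) chart = "'a set \<times> ('a \<Rightarrow> complex^'n)"

definition coord_image :: "('a, 'n) chart \<Rightarrow> (complex^'n) set" where
  "coord_image c = snd c ` fst c"

definition param :: "('a, 'n) chart \<Rightarrow> complex^'n \<Rightarrow> 'a" where
  "param c = inv_into (fst c) (snd c)"

definition transition :: "('a, 'n) chart \<Rightarrow> ('a, 'n) chart \<Rightarrow> complex^'n \<Rightarrow> complex^'n" where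
  "transition c d = snd d \<circ> param c"

definition complex_atlas :: "('a::t2_space, 'n::finite) chart set \<Rightarrow> bool" where
  "complex_atlas A \<longleftrightarrow>
     (\<Union>c\<in>A. fst c) = UNIV \<and>
     (\<forall>c\<in>A. open (fst c) \<and> open (coord_image c) \<and>
             homeomorphism (fst c) (coord_image c) (snd c) (param c)) \<and>
     (\<forall>c\<in>A. \<forall>d\<in>A. holomorphic_map_on (snd c ` (fst c \<inter> fst d)) (transition c d))"

definition smooth_fun :: "('a, 'n::finite) chart set \<Rightarrow> ('a \<Rightarrow> real) \<Rightarrow> bool" where
  "smooth_fun A f \<longleftrightarrow> (\<forall>c\<in>A. C_infty_on (coord_image c) (f \<circ> param c))"

text \<open>A smooth family of functions on \<open>M\<close>, with parameter in an open set \<open>P\<close> of a normed space, is a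
  function that is smooth on \<open>P \<times> M\<close>. For finite-dimensional parameters these are exactly the smooth
  maps from \<open>P\<close> to the Frechet space \<open>C\<^sup>\<infinity>(M)\<close>.\<close>

definition smooth_param ::
  "('a, 'n::finite) chart set \<Rightarrow> 'p::real_normed_vector set \<Rightarrow> ('p \<Rightarrow> 'a \<Rightarrow> real) \<Rightarrow> bool" where
  "smooth_param A P F \<longleftrightarrow>
     (\<forall>c\<in>A. C_infty_on (P \<times> coord_image c) (\<lambda>(q, z). F q (param c z)))"

text \<open>A 2-form is given by its local expressions: \<open>\<omega> c z u v\<close> is the value at the point with
  coordinates \<open>z\<close> in the chart \<open>c\<close>, on the tangent vectors represented there by \<open>u\<close> and \<open>v\<close>.\<close>

type_synonym ('a, 'n) two_form =
  "('a, 'n) chart \<Rightarrow> complex^'n \<Rightarrow> complex^'n \<Rightarrow> complex^'n \<Rightarrow> real"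

definition smooth_two_form :: "('a, 'n::finite) chart set \<Rightarrow> ('a, 'n) two_form \<Rightarrow> bool" where
  "smooth_two_form A \<omega> \<longleftrightarrow>
     (\<forall>c\<in>A. \<forall>z\<in>coord_image c. bilinear (\<omega> c z) \<and> (\<forall>u v. \<omega> c z u v = - \<omega> c z v u)) \<and>
     (\<forall>c\<in>A. \<forall>u v. C_infty_on (coord_image c) (\<lambda>z. \<omega> c z u v)) \<and>
     (\<forall>c\<in>A. \<forall>d\<in>A. \<forall>z\<in>snd c ` (fst c \<inter> fst d). \<forall>u v.
        \<omega> c z u v = \<omega> d (transition c d z)
           (frechet_derivative (transition c d) (at z) u)
           (frechet_derivative (transition c d) (at z) v))"

text \<open>\<open>d\<omega>(u, v, w)\<close> evaluated on constant coordinate vector fields.\<close>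

definition closed_two_form :: "('a, 'n::finite) chart set \<Rightarrow> ('a, 'n) two_form \<Rightarrow> bool" where
  "closed_two_form A \<omega> \<longleftrightarrow>
     (\<forall>c\<in>A. \<forall>z\<in>coord_image c. \<forall>u v w.
        frechet_derivative (\<lambda>y. \<omega> c y v w) (at z) u
      + frechet_derivative (\<lambda>y. \<omega> c y w u) (at z) v
      + frechet_derivative (\<lambda>y. \<omega> c y u v) (at z) w = 0)"

definition kaehler_form :: "('a, 'n::finite) chart set \<Rightarrow> ('a, 'n) two_form \<Rightarrow> bool" where
  "kaehler_form A \<omega> \<longleftrightarrow>
     smooth_two_form A \<omega> \<and> closed_two_form A \<omega> \<and>
     (\<forall>c\<in>A. \<forall>z\<in>coord_image c. \<forall>u v. \<omega> c z (\<i> *s u) (\<i> *s v) = \<omega> c z u v) \<and>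
     (\<forall>c\<in>A. \<forall>z\<in>coord_image c. \<forall>u. u \<noteq> 0 \<longrightarrow> \<omega> c z u (\<i> *s u) > 0)"

definition kaehler_manifold :: "('a::t2_space, 'n::finite) chart set \<Rightarrow> ('a, 'n) two_form \<Rightarrow> bool" where
  "kaehler_manifold A \<omega> \<longleftrightarrow> complex_atlas A \<and> kaehler_form A \<omega>"

text \<open>The real coordinate basis \<open>\<partial>/\<partial>x\<^sub>j, \<partial>/\<partial>y\<^sub>j\<close>; listed as \<open>x\<^sub>1, y\<^sub>1, \<dots>, x\<^sub>n, y\<^sub>n\<close> it is positively
  oriented.\<close>

definition real_basis :: "'n::finite \<times> bool \<Rightarrow> complex^'n" where
  "real_basis = (\<lambda>(j, y). axis j (if y then \<i> else 1))"

text \<open>The coefficient of \<open>dx\<^sub>1 \<and> dy\<^sub>1 \<and> \<dots> \<and> dx\<^sub>n \<and> dy\<^sub>n\<close> in the \<open>n\<close>-fold wedge power of \<open>\<omega>\<close>, i.e.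
  the wedge power evaluated on the oriented basis, with the convention
  \<open>(\<alpha>\<^sub>1 \<and> \<dots> \<and> \<alpha>\<^sub>n)(v\<^sub>1, \<dots>, v\<^sub>2\<^sub>n) = 2\<^sup>-\<^sup>n \<Sum>\<^sub>\<sigma> sgn \<sigma> \<Prod>\<^sub>k \<alpha>\<^sub>k(v\<^sub>\<sigma>\<^sub>(\<^sub>2\<^sub>k\<^sub>-\<^sub>1\<^sub>), v\<^sub>\<sigma>\<^sub>(\<^sub>2\<^sub>k\<^sub>))\<close>
  for 2-forms \<open>\<alpha>\<^sub>k\<close>.\<close>

definition top_power :: "('a, 'n::finite) two_form \<Rightarrow> ('a, 'n) chart \<Rightarrow> complex^'n \<Rightarrow> real" where
  "top_power \<omega> c z =
     (\<Sum>\<sigma> | \<sigma> permutes (UNIV :: ('n \<times> bool) set).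
        of_int (sign \<sigma>) *
        (\<Prod>j\<in>UNIV. \<omega> c z (real_basis (\<sigma> (j, False))) (real_basis (\<sigma> (j, True)))))
     / 2 ^ CARD('n)"

text \<open>The integral of a top form is defined by a partition of unity, as usual; its value does not
  depend on the choice. Only continuous forms are integrated, so a continuous partition is enough.\<close>

definition partition_of_unity ::
  "('a::t2_space, 'n::finite) chart set \<Rightarrow> ('a, 'n) chart set \<times> (('a, 'n) chart \<Rightarrow> 'a \<Rightarrow> real) \<Rightarrow> bool" where
  "partition_of_unity A = (\<lambda>(C, p).
     finite C \<and> C \<subseteq> A \<and>
     (\<forall>c\<in>C. continuous_on UNIV (p c) \<and> (\<forall>x. 0 \<le> p c x) \<and> closure {x. p c x \<noteq> 0} \<subseteq> fst c) \<and>
     (\<forall>x. (\<Sum>c\<in>C. p c x) = 1))"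

text \<open>\<open>\<integral>\<^sub>M f \<omega>\<^sup>n\<close>, in which \<open>lborel\<close> is the measure \<open>dx\<^sub>1 dy\<^sub>1 \<dots> dx\<^sub>n dy\<^sub>n\<close>.\<close>

definition integral_omega_n ::
  "('a::t2_space, 'n::finite) chart set \<Rightarrow> ('a, 'n) two_form \<Rightarrow> ('a \<Rightarrow> real) \<Rightarrow> real" where
  "integral_omega_n A \<omega> f =
     (let (C, p) = (SOME Cp. partition_of_unity A Cp) in
       \<Sum>c\<in>C. LINT z:coord_image c|lborel. p c (param c z) * f (param c z) * top_power \<omega> c z)"

definition integral_vol ::
  "('a::t2_space, 'n::finite) chart set \<Rightarrow> ('a, 'n) two_form \<Rightarrow> ('a \<Rightarrow> real) \<Rightarrow> real" where
  "integral_vol A \<omega> f = integral_omega_n A \<omega> f / fact CARD('n)"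

definition conformal_factors ::
  "('a::t2_space, 'n::finite) chart set \<Rightarrow> ('a, 'n) two_form \<Rightarrow> ('a \<Rightarrow> real) set" where
  "conformal_factors A \<omega> =
     {F. smooth_fun A F \<and> (\<forall>x. F x > 0) \<and> integral_omega_n A \<omega> F = integral_omega_n A \<omega> (\<lambda>_. 1)}"

text \<open>The tangent space, which is the same at every point.\<close>

definition conformal_tangent ::
  "('a::t2_space, 'n::finite) chart set \<Rightarrow> ('a, 'n) two_form \<Rightarrow> ('a \<Rightarrow> real) set" where
  "conformal_tangent A \<omega> = {G. smooth_fun A G \<and> integral_omega_n A \<omega> G = 0}"

definition weighted_metric ::
  "('a::t2_space, 'n::finite) chart set \<Rightarrow> ('a, 'n) two_form \<Rightarrow> (real \<Rightarrow> real) \<Rightarrow>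
   ('a \<Rightarrow> real) \<Rightarrow> ('a \<Rightarrow> real) \<Rightarrow> ('a \<Rightarrow> real) \<Rightarrow> real" where
  "weighted_metric A \<omega> chi F G1 G2 = integral_vol A \<omega> (\<lambda>x. chi (F x) * G1 x * G2 x)"

definition open_interval :: "real set \<Rightarrow> bool" where
  "open_interval I \<longleftrightarrow> open I \<and> is_interval I \<and> I \<noteq> {}"

text \<open>Values of curves, fields and families outside the parameter intervals are irrelevant.\<close>

definition smooth_curve ::
  "('a::t2_space, 'n::finite) chart set \<Rightarrow> ('a, 'n) two_form \<Rightarrow> real set \<Rightarrow> (real \<Rightarrow> 'a \<Rightarrow> real) \<Rightarrow> bool" where
  "smooth_curve A \<omega> I F \<longleftrightarrow>
     open_interval I \<and> smooth_param A I F \<and> (\<forall>t\<in>I. F t \<in> conformal_factors A \<omega>)"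

definition smooth_field ::
  "('a::t2_space, 'n::finite) chart set \<Rightarrow> ('a, 'n) two_form \<Rightarrow> real set \<Rightarrow> (real \<Rightarrow> 'a \<Rightarrow> real) \<Rightarrow> bool" where
  "smooth_field A \<omega> I G \<longleftrightarrow>
     open_interval I \<and> smooth_param A I G \<and> (\<forall>t\<in>I. G t \<in> conformal_tangent A \<omega>)"

definition smooth_family ::
  "('a::t2_space, 'n::finite) chart set \<Rightarrow> ('a, 'n) two_form \<Rightarrow> real set \<Rightarrow> real set \<Rightarrow>
   (real \<Rightarrow> real \<Rightarrow> 'a \<Rightarrow> real) \<Rightarrow> bool" where
  "smooth_family A \<omega> I J F \<longleftrightarrow>
     open_interval I \<and> open_interval J \<and> smooth_param A (I \<times> J) (\<lambda>(t, s). F t s) \<and>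
     (\<forall>t\<in>I. \<forall>s\<in>J. F t s \<in> conformal_factors A \<omega>)"

definition velocity :: "(real \<Rightarrow> 'a \<Rightarrow> real) \<Rightarrow> real \<Rightarrow> 'a \<Rightarrow> real" where
  "velocity F t x = deriv (\<lambda>\<tau>. F \<tau> x) t"

text \<open>\<open>D I F G t\<close> is the covariant derivative at time \<open>t\<close> of the vector field \<open>G\<close> along the curve
  \<open>F\<close>, both with parameter interval \<open>I\<close>. The last clause fixes \<open>D\<close> outside its domain, so that
  it can be unique as a total function.\<close>

type_synonym 'a covariant_derivative =
  "real set \<Rightarrow> (real \<Rightarrow> 'a \<Rightarrow> real) \<Rightarrow> (real \<Rightarrow> 'a \<Rightarrow> real) \<Rightarrow> real \<Rightarrow> 'a \<Rightarrow> real"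

definition is_levi_civita ::
  "('a::t2_space, 'n::finite) chart set \<Rightarrow> ('a, 'n) two_form \<Rightarrow> (real \<Rightarrow> real) \<Rightarrow>
   'a covariant_derivative \<Rightarrow> bool" where
  "is_levi_civita A \<omega> chi D \<longleftrightarrow>
     (\<forall>I F G. smooth_curve A \<omega> I F \<and> smooth_field A \<omega> I G \<longrightarrow> smooth_field A \<omega> I (D I F G)) \<and>
     (\<forall>I F G H. smooth_curve A \<omega> I F \<and> smooth_field A \<omega> I G \<and> smooth_field A \<omega> I H \<longrightarrow>
        (\<forall>t\<in>I. \<forall>x. D I F (\<lambda>t x. G t x + H t x) t x = D I F G t x + D I F H t x)) \<and>
     (\<forall>I F G f. smooth_curve A \<omega> I F \<and> smooth_field A \<omega> I G \<and> C_infty_on I f \<longrightarrow>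
        (\<forall>t\<in>I. \<forall>x. D I F (\<lambda>t x. f t * G t x) t x = deriv f t * G t x + f t * D I F G t x)) \<and>
     (\<forall>I F G H. smooth_curve A \<omega> I F \<and> smooth_field A \<omega> I G \<and> smooth_field A \<omega> I H \<longrightarrow>
        (\<forall>t\<in>I. ((\<lambda>t. weighted_metric A \<omega> chi (F t) (G t) (H t)) has_real_derivative
           weighted_metric A \<omega> chi (F t) (D I F G t) (H t)
         + weighted_metric A \<omega> chi (F t) (G t) (D I F H t)) (at t))) \<and>
     (\<forall>I J F. smooth_family A \<omega> I J F \<longrightarrow>
        (\<forall>t\<in>I. \<forall>s\<in>J.
           D I (\<lambda>t. F t s) (\<lambda>t. velocity (\<lambda>s. F t s) s) t
         = D J (\<lambda>s. F t s) (\<lambda>s. velocity (\<lambda>t. F t s) t) s)) \<and>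
     (\<forall>I F G t. \<not> (smooth_curve A \<omega> I F \<and> smooth_field A \<omega> I G \<and> t \<in> I) \<longrightarrow>
        D I F G t = undefined)"

definition levi_civita ::
  "('a::t2_space, 'n::finite) chart set \<Rightarrow> ('a, 'n) two_form \<Rightarrow> (real \<Rightarrow> real) \<Rightarrow>
   'a covariant_derivative" where
  "levi_civita A \<omega> chi = (THE D. is_levi_civita A \<omega> chi D)"

end

theory Submission
  imports Defs
begin

text \<open>
  The formula comes from an orthogonal projection. On the space of all positive functions, where no volume
  constraint is imposed, the Levi-Civita derivative of the weighted metric along a curve \<open>F\<close> is
  \<open>\<nabla>G = \<partial>\<^sub>t G + \<chi>'(F)/(2\<chi>(F)) (\<partial>\<^sub>t F) G\<close>: it is
  compatible with the metric because each factor contributes half of the derivative of the weight, and torsion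
  free because the last term is symmetric in \<open>\<partial>\<^sub>t F\<close> and \<open>G\<close>. The
  volume conformal factors are cut out by one linear condition, and for
  \<open>\<langle>_,_\<rangle>\<^sub>F\<close> the orthogonal complement of the tangent space is spanned by
  \<open>1/\<chi>(F)\<close>, because \<open>\<langle>1/\<chi>(F), H\<rangle>\<^sub>F\<close> is the integral of
  \<open>H\<close>. The operator \<open>covariant\<close> is \<open>\<nabla>\<close> followed by the projection
  along \<open>1/\<chi>(F)\<close>; for \<open>G = \<partial>\<^sub>t F\<close> this is the left side of the
  geodesic equation.

  Since \<open>levi_civita\<close> is a definite description, this operator has to satisfy all the axioms
  (\<open>is_levi_civita_connection\<close>) and has to be the only one that does
  (\<open>levi_civita_unique\<close>). The space is infinite dimensional, so uniqueness cannot be read off from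
  Christoffel symbols in a finite frame. Instead, let \<open>S\<close> be the difference of two solutions.
  Compatibility with the metric makes \<open>S\<close> skew, and a skew operator tested against constant fields
  can depend on a field only through its value at the given time (\<open>gap_pointwise\<close>). Torsion
  freeness, applied to a family through the curve whose transversal curve is a segment, exchanges the velocity
  and the field (\<open>gap_swap\<close>); in particular \<open>S\<close> depends on the curve only through its
  point and velocity. A function of three vectors that is symmetric in the first two and skew in the last two
  vanishes, which is the algebra of Koszul's formula (\<open>gap_eq_0\<close>), and the metric is definite.

  Analytically, the argument rests on three properties of the integral: it is linear, it is strictly positive on
  nonzero nonnegative continuous functions, and it commutes with derivatives in a parameter
  (\<open>vol_pos\<close>, \<open>vol_has_derivative\<close>). Strict positivity rests on
  \<open>\<omega>\<^sup>n > 0\<close>, proved in \<open>form_power_real_basis_pos\<close> by evaluating the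
  wedge power on an orthogonal basis and deforming the form to the standard one.
\<close>

section \<open>Functions of class \<open>C\<^sup>k\<close>\<close>

lemma has_derivative_frechet:
  "f differentiable (at x) \<Longrightarrow> (f has_derivative frechet_derivative f (at x)) (at x)"
  by (simp add: frechet_derivative_works)

lemma frechet_derivative_eq:
  "(f has_derivative f') (at x) \<Longrightarrow> frechet_derivative f (at x) = f'"
  using frechet_derivative_at by metis

lemma C_upto_imp_continuous_on: "C_upto k S f \<Longrightarrow> continuous_on S f"
  by (cases k) (auto intro!: continuous_at_imp_continuous_on differentiable_imp_continuous_within)

lemma C_upto_Suc_imp: "C_upto (Suc k) S f \<Longrightarrow> C_upto k S f"
proof (induction k arbitrary: f)
  case 0
  then show ?case using C_upto_imp_continuous_on[of "Suc 0"] by simp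
next
  case (Suc k)
  then show ?case by (metis C_upto.simps(2))
qed

text \<open>The derivatives in the recursion are full derivatives at points, so on an open set the class
  depends only on the values there.\<close>

lemma C_upto_cong:
  assumes "open S" "\<And>x. x \<in> S \<Longrightarrow> f x = g x" "C_upto k S f"
  shows "C_upto k S g"
  using assms(2,3)
proof (induction k arbitrary: f g)
  case 0
  then show ?case by (simp cong: continuous_on_cong)
next
  case (Suc k)
  have der: "(g has_derivative frechet_derivative f (at x)) (at x)" if "x \<in> S" for x
    by (rule has_derivative_transform_within_open[OF has_derivative_frechet assms(1) that])
      (use Suc.prems that in auto)
  show ?case
    unfolding C_upto.simps
  proof (intro conjI ballI allI)
    show "g differentiable at x" if "x \<in> S" for x
      using der[OF that] differentiable_def by blast
    show "C_upto k S (\<lambda>x. frechet_derivative g (at x) v)" for v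
      by (rule Suc.IH[of "\<lambda>x. frechet_derivative f (at x) v"])
        (use Suc.prems frechet_derivative_eq[OF der] in auto)
  qed
qed

lemma C_upto_SucI:
  assumes "open S" "\<And>x. x \<in> S \<Longrightarrow> (f has_derivative f' x) (at x)" "\<And>v. C_upto k S (\<lambda>x. f' x v)"
  shows "C_upto (Suc k) S f"
  unfolding C_upto.simps
proof (intro conjI ballI allI)
  show "f differentiable at x" if "x \<in> S" for x
    using assms(2)[OF that] differentiable_def by blast
  show "C_upto k S (\<lambda>x. frechet_derivative f (at x) v)" for v
    by (rule C_upto_cong[OF assms(1) _ assms(3)[of v]]) (simp add: frechet_derivative_eq[OF assms(2)])
qed

lemma C_upto_has_derivative:
  "C_upto (Suc k) S f \<Longrightarrow> x \<in> S \<Longrightarrow> (f has_derivative frechet_derivative f (at x)) (at x)"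
  by (simp add: has_derivative_frechet)

lemma C_upto_const: "open S \<Longrightarrow> C_upto k S (\<lambda>_. c)"
proof (induction k arbitrary: c)
  case (Suc k)
  then show ?case by (intro C_upto_SucI[where f' = "\<lambda>_ _. 0"]) auto
qed simp

lemma C_upto_bounded_linear:
  assumes "open S" "bounded_linear f"
  shows "C_upto k S f"
proof (cases k)
  case 0
  then show ?thesis using assms by (simp add: linear_continuous_on)
next
  case (Suc m)
  show ?thesis unfolding Suc
    by (rule C_upto_SucI[OF assms(1), where f' = "\<lambda>_. f"])
      (use assms in \<open>auto intro: bounded_linear_imp_has_derivative C_upto_const\<close>)
qed

lemma C_upto_add:
  assumes "open S" "C_upto k S f" "C_upto k S g"
  shows "C_upto k S (\<lambda>x. f x + g x)"
  using assms(2,3)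
proof (induction k arbitrary: f g)
  case 0
  then show ?case by (simp add: continuous_on_add)
next
  case (Suc k)
  show ?case
    by (rule C_upto_SucI[OF assms(1), where
          f' = "\<lambda>x v. frechet_derivative f (at x) v + frechet_derivative g (at x) v"])
      (use Suc in \<open>auto intro!: has_derivative_add has_derivative_frechet\<close>)
qed

lemma C_upto_mult:
  fixes f g :: "'a::real_normed_vector \<Rightarrow> real"
  assumes "open S" "C_upto k S f" "C_upto k S g"
  shows "C_upto k S (\<lambda>x. f x * g x)"
  using assms(2,3)
proof (induction k arbitrary: f g)
  case 0
  then show ?case by (simp add: continuous_on_mult)
next
  case (Suc k)
  show ?case
  proof (rule C_upto_SucI[OF assms(1), where
          f' = "\<lambda>x v. f x * frechet_derivative g (at x) v + frechet_derivative f (at x) v * g x"])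
    show "((\<lambda>x. f x * g x) has_derivative
        (\<lambda>v. f x * frechet_derivative g (at x) v + frechet_derivative f (at x) v * g x)) (at x)"
      if "x \<in> S" for x
      by (rule has_derivative_mult) (use Suc.prems that in \<open>auto intro: has_derivative_frechet\<close>)
    show "C_upto k S (\<lambda>x. f x * frechet_derivative g (at x) v + frechet_derivative f (at x) v * g x)" for v
      using Suc.prems C_upto_Suc_imp[OF Suc.prems(1)] C_upto_Suc_imp[OF Suc.prems(2)]
      by (intro C_upto_add assms(1) Suc.IH) auto
  qed
qed

lemma C_upto_compose_real:
  fixes f :: "'a::real_normed_vector \<Rightarrow> real" and g :: "real \<Rightarrow> real"
  assumes "open S" "open T" "f ` S \<subseteq> T" "C_upto k S f" "C_upto k T g"
  shows "C_upto k S (\<lambda>x. g (f x))"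
  using assms(4,5)
proof (induction k arbitrary: g)
  case 0
  then show ?case using assms(3) continuous_on_compose2[of T g S f] by simp
next
  case (Suc k)
  have lin: "frechet_derivative g (at r) h = frechet_derivative g (at r) 1 * h" if "r \<in> T" for r h
  proof -
    have "linear (frechet_derivative g (at r))"
      using Suc.prems(2) that by (auto intro: linear_frechet_derivative)
    from linear_scale[OF this, of h 1] show ?thesis by simp
  qed
  show ?case
  proof (rule C_upto_SucI[OF assms(1), where
          f' = "\<lambda>x v. frechet_derivative g (at (f x)) 1 * frechet_derivative f (at x) v"])
    fix x assume x: "x \<in> S"
    have "(g \<circ> f has_derivative frechet_derivative g (at (f x)) \<circ> frechet_derivative f (at x)) (at x)"
      by (rule diff_chain_at) (use Suc.prems assms(3) x in \<open>auto intro!: has_derivative_frechet\<close>)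
    moreover have "f x \<in> T" using assms(3) x by auto
    ultimately show "((\<lambda>x. g (f x)) has_derivative
        (\<lambda>v. frechet_derivative g (at (f x)) 1 * frechet_derivative f (at x) v)) (at x)"
      unfolding comp_def by (simp only: lin[of "f x" "frechet_derivative f (at x) _"])
  next
    show "C_upto k S (\<lambda>x. frechet_derivative g (at (f x)) 1 * frechet_derivative f (at x) v)" for v
      using Suc.prems C_upto_Suc_imp[OF Suc.prems(1)]
      by (intro C_upto_mult assms(1) Suc.IH[of "\<lambda>r. frechet_derivative g (at r) 1"]) auto
  qed
qed

text \<open>Freezing a parameter, forgetting a variable, and restricting a family to a line are all
  compositions with affine maps.\<close>

lemma C_upto_compose_affine:
  assumes "open S" "bounded_linear l" "\<And>x. x \<in> S \<Longrightarrow> a + l x \<in> T" "C_upto k T f"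
  shows "C_upto k S (\<lambda>x. f (a + l x))"
  using assms(4)
proof (induction k arbitrary: f)
  case 0
  have "continuous_on S (\<lambda>x. a + l x)"
    by (intro continuous_intros linear_continuous_on assms)
  then show ?case using 0 assms(3) continuous_on_compose2[of T f S "\<lambda>x. a + l x"] by auto
next
  case (Suc k)
  show ?case
  proof (rule C_upto_SucI[OF assms(1), where f' = "\<lambda>x v. frechet_derivative f (at (a + l x)) (l v)"])
    fix x assume x: "x \<in> S"
    have "((\<lambda>x. a + l x) has_derivative l) (at x)"
      using has_derivative_add[OF has_derivative_const bounded_linear_imp_has_derivative[OF assms(2)], of a]
      by simp
    moreover have "(f has_derivative frechet_derivative f (at (a + l x))) (at (a + l x))"
      using Suc.prems assms(3)[OF x] by (auto intro!: has_derivative_frechet)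
    ultimately show "((\<lambda>x. f (a + l x)) has_derivative
        (\<lambda>v. frechet_derivative f (at (a + l x)) (l v))) (at x)"
      using diff_chain_at[of "\<lambda>x. a + l x" l x f] by (simp add: comp_def)
  next
    show "C_upto k S (\<lambda>x. frechet_derivative f (at (a + l x)) (l v))" for v
      using Suc.prems by (intro Suc.IH) auto
  qed
qed

lemma C_upto_inverse: "C_upto k {0<..} (inverse :: real \<Rightarrow> real)"
proof (induction k)
  case 0
  show ?case by (auto intro!: continuous_intros)
next
  case (Suc k)
  have op: "open {0::real<..}" by simp
  have der: "((inverse :: real \<Rightarrow> real) has_derivative (\<lambda>v. - (inverse x * v * inverse x))) (at x)"
    if "x \<in> {0<..}" for x :: real
    using that by (intro has_derivative_inverse') simp
  have C: "C_upto k {0<..} (\<lambda>x::real. - (inverse x * v * inverse x))" for v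
    using C_upto_mult[OF op C_upto_mult[OF op Suc C_upto_const[OF op, of k "- v"]] Suc]
    unfolding mult_minus_left mult_minus_right .
  show ?case
    by (rule C_upto_SucI[OF op, where f' = "\<lambda>x v. - (inverse x * v * inverse x)"]) (fact der, fact C)
qed

lemma C_infty_onD: "C_infty_on S f \<Longrightarrow> C_upto k S f"
  unfolding C_infty_on_def by blast

lemma C_infty_on_cong:
  "open S \<Longrightarrow> (\<And>x. x \<in> S \<Longrightarrow> f x = g x) \<Longrightarrow> C_infty_on S f \<Longrightarrow> C_infty_on S g"
  unfolding C_infty_on_def by (metis C_upto_cong)

lemma C_infty_on_imp_continuous_on: "C_infty_on S f \<Longrightarrow> continuous_on S f"
  by (metis C_infty_onD C_upto_imp_continuous_on)

lemma C_infty_on_has_derivative: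
  "C_infty_on S f \<Longrightarrow> x \<in> S \<Longrightarrow> (f has_derivative frechet_derivative f (at x)) (at x)"
  by (metis C_infty_onD C_upto_has_derivative)

lemma C_infty_on_frechet_derivative:
  "C_infty_on S f \<Longrightarrow> C_infty_on S (\<lambda>x. frechet_derivative f (at x) v)"
  unfolding C_infty_on_def by (metis C_upto.simps(2))

lemma C_infty_on_const: "open S \<Longrightarrow> C_infty_on S (\<lambda>_. c)"
  by (simp add: C_infty_on_def C_upto_const)

lemma C_infty_on_add:
  "open S \<Longrightarrow> C_infty_on S f \<Longrightarrow> C_infty_on S g \<Longrightarrow> C_infty_on S (\<lambda>x. f x + g x)"
  by (simp add: C_infty_on_def C_upto_add)

lemma C_infty_on_mult:
  fixes f g :: "'a::real_normed_vector \<Rightarrow> real"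
  shows "open S \<Longrightarrow> C_infty_on S f \<Longrightarrow> C_infty_on S g \<Longrightarrow> C_infty_on S (\<lambda>x. f x * g x)"
  by (simp add: C_infty_on_def C_upto_mult)

lemma C_infty_on_compose_real:
  fixes f :: "'a::real_normed_vector \<Rightarrow> real" and g :: "real \<Rightarrow> real"
  shows "open S \<Longrightarrow> open T \<Longrightarrow> f ` S \<subseteq> T \<Longrightarrow> C_infty_on S f \<Longrightarrow> C_infty_on T g \<Longrightarrow>
    C_infty_on S (\<lambda>x. g (f x))"
  unfolding C_infty_on_def using C_upto_compose_real by blast

lemma C_infty_on_compose_affine:
  "open S \<Longrightarrow> bounded_linear l \<Longrightarrow> (\<And>x. x \<in> S \<Longrightarrow> a + l x \<in> T) \<Longrightarrow> C_infty_on T f \<Longrightarrow>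
    C_infty_on S (\<lambda>x. f (a + l x))"
  unfolding C_infty_on_def using C_upto_compose_affine by blast

lemma C_infty_on_inverse: "C_infty_on {0<..} (inverse :: real \<Rightarrow> real)"
  by (simp add: C_infty_on_def C_upto_inverse)

lemma C_infty_on_real_has_derivative:
  fixes f :: "real \<Rightarrow> real"
  assumes "C_infty_on S f" "x \<in> S"
  shows "(f has_real_derivative deriv f x) (at x)"
proof -
  have "f differentiable at x"
    using C_infty_on_has_derivative[OF assms] differentiable_def by blast
  then show ?thesis
    using DERIV_deriv_iff_real_differentiable by blast
qed

lemma C_infty_on_deriv:
  fixes f :: "real \<Rightarrow> real"
  assumes "open S" "C_infty_on S f"
  shows "C_infty_on S (deriv f)"
proof (rule C_infty_on_cong[OF assms(1) _ C_infty_on_frechet_derivative[OF assms(2), of 1]])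
  fix x assume "x \<in> S"
  then have "(f has_derivative (\<lambda>h. deriv f x * h)) (at x)"
    using C_infty_on_real_has_derivative[OF assms(2)] by (simp add: has_field_derivative_def)
  then show "frechet_derivative f (at x) 1 = deriv f x"
    by (simp add: frechet_derivative_eq)
qed

lemma mixed_second_differences:
  fixes f fx fxy :: "real \<Rightarrow> real \<Rightarrow> real"
  assumes "h > 0"
    and "\<And>\<tau> \<sigma>. t \<le> \<tau> \<Longrightarrow> \<tau> \<le> t + h \<Longrightarrow> s \<le> \<sigma> \<Longrightarrow> \<sigma> \<le> s + h \<Longrightarrow>
      ((\<lambda>\<tau>. f \<tau> \<sigma>) has_real_derivative fx \<tau> \<sigma>) (at \<tau>)"
    and "\<And>\<tau> \<sigma>. t \<le> \<tau> \<Longrightarrow> \<tau> \<le> t + h \<Longrightarrow> s \<le> \<sigma> \<Longrightarrow> \<sigma> \<le> s + h \<Longrightarrow>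
      ((\<lambda>\<sigma>. fx \<tau> \<sigma>) has_real_derivative fxy \<tau> \<sigma>) (at \<sigma>)"
  obtains \<tau> \<sigma> where "t \<le> \<tau>" "\<tau> \<le> t + h" "s \<le> \<sigma>" "\<sigma> \<le> s + h"
    "f (t + h) (s + h) - f (t + h) s - f t (s + h) + f t s = h * (h * fxy \<tau> \<sigma>)"
proof -
  have "\<exists>\<tau>>t. \<tau> < t + h \<and> (f (t + h) (s + h) - f (t + h) s) - (f t (s + h) - f t s)
      = (t + h - t) * (fx \<tau> (s + h) - fx \<tau> s)"
    by (rule MVT2) (use assms in \<open>auto intro!: derivative_intros\<close>)
  then obtain \<tau> where \<tau>: "t < \<tau>" "\<tau> < t + h"
    "(f (t + h) (s + h) - f (t + h) s) - (f t (s + h) - f t s) = h * (fx \<tau> (s + h) - fx \<tau> s)"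
    by auto
  have "\<exists>\<sigma>>s. \<sigma> < s + h \<and> fx \<tau> (s + h) - fx \<tau> s = (s + h - s) * fxy \<tau> \<sigma>"
    by (rule MVT2) (use assms \<tau> in auto)
  then obtain \<sigma> where \<sigma>: "s < \<sigma>" "\<sigma> < s + h" "fx \<tau> (s + h) - fx \<tau> s = h * fxy \<tau> \<sigma>"
    by auto
  show thesis
    by (rule that[of \<tau> \<sigma>]) (use \<tau> \<sigma> in \<open>auto simp: algebra_simps\<close>)
qed

text \<open>The second difference quotient over a small square is a value of either iterated derivative
  at some point of the square, by the mean value theorem applied in either order of the variables.
  Continuity brings both points to \<open>(t, s)\<close>.\<close>

lemma mixed_partials_eq:
  fixes f fx fy fxy fyx :: "real \<Rightarrow> real \<Rightarrow> real"
  assumes S: "open S" "(t, s) \<in> S"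
    and fx: "\<And>\<tau> \<sigma>. (\<tau>, \<sigma>) \<in> S \<Longrightarrow> ((\<lambda>\<tau>. f \<tau> \<sigma>) has_real_derivative fx \<tau> \<sigma>) (at \<tau>)"
    and fxy: "\<And>\<tau> \<sigma>. (\<tau>, \<sigma>) \<in> S \<Longrightarrow> ((\<lambda>\<sigma>. fx \<tau> \<sigma>) has_real_derivative fxy \<tau> \<sigma>) (at \<sigma>)"
    and fy: "\<And>\<tau> \<sigma>. (\<tau>, \<sigma>) \<in> S \<Longrightarrow> ((\<lambda>\<sigma>. f \<tau> \<sigma>) has_real_derivative fy \<tau> \<sigma>) (at \<sigma>)"
    and fyx: "\<And>\<tau> \<sigma>. (\<tau>, \<sigma>) \<in> S \<Longrightarrow> ((\<lambda>\<tau>. fy \<tau> \<sigma>) has_real_derivative fyx \<tau> \<sigma>) (at \<tau>)"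
    and cont: "continuous_on S (\<lambda>(\<tau>, \<sigma>). fxy \<tau> \<sigma>)" "continuous_on S (\<lambda>(\<tau>, \<sigma>). fyx \<tau> \<sigma>)"
  shows "fxy t s = fyx t s"
proof (rule ccontr)
  assume "fxy t s \<noteq> fyx t s"
  define e where "e = \<bar>fxy t s - fyx t s\<bar> / 2"
  have e: "e > 0" using \<open>fxy t s \<noteq> fyx t s\<close> by (simp add: e_def)
  have near: "\<exists>d>0. \<forall>q. dist q (t, s) < d \<longrightarrow> q \<in> S \<and> dist (g q) (g (t, s)) < e"
    if "continuous_on S g" for g :: "real \<times> real \<Rightarrow> real"
  proof -
    have "isCont g (t, s)" using that S continuous_on_eq_continuous_at by blast
    then obtain d where d: "d > 0" "\<And>q. dist q (t, s) < d \<Longrightarrow> dist (g q) (g (t, s)) < e"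
      using e by (auto simp: continuous_at_eps_delta)
    obtain d' where d': "d' > 0" "ball (t, s) d' \<subseteq> S" using S openE by blast
    show ?thesis
      by (rule exI[of _ "min d d'"]) (use d d' in \<open>auto simp: dist_commute\<close>)
  qed
  obtain d1 where d1: "d1 > 0" "\<And>q. dist q (t, s) < d1 \<Longrightarrow>
      q \<in> S \<and> dist ((\<lambda>(\<tau>, \<sigma>). fxy \<tau> \<sigma>) q) ((\<lambda>(\<tau>, \<sigma>). fxy \<tau> \<sigma>) (t, s)) < e"
    using near[OF cont(1)] by blast
  obtain d2 where d2: "d2 > 0" "\<And>q. dist q (t, s) < d2 \<Longrightarrow>
      q \<in> S \<and> dist ((\<lambda>(\<tau>, \<sigma>). fyx \<tau> \<sigma>) q) ((\<lambda>(\<tau>, \<sigma>). fyx \<tau> \<sigma>) (t, s)) < e"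
    using near[OF cont(2)] by blast
  (* A square of side h has diameter at most 2 h, so it lies in both neighbourhoods. *)
  define h where "h = min d1 d2 / 3"
  have h: "h > 0" "3 * h \<le> d1" "3 * h \<le> d2" using d1(1) d2(1) by (auto simp: h_def)
  have box: "dist (\<tau>, \<sigma>) (t, s) < 3 * h"
    if "t \<le> \<tau>" "\<tau> \<le> t + h" "s \<le> \<sigma>" "\<sigma> \<le> s + h" for \<tau> \<sigma>
  proof -
    have "dist (\<tau>, \<sigma>) (t, s) \<le> \<bar>dist \<tau> t\<bar> + \<bar>dist \<sigma> s\<bar>"
      unfolding dist_Pair_Pair by (rule sqrt_sum_squares_le_sum_abs)
    also have "\<dots> \<le> h + h" using that by (auto simp: dist_real_def)
    finally show ?thesis using h by simp
  qed
  have inS: "(\<tau>, \<sigma>) \<in> S" if "t \<le> \<tau>" "\<tau> \<le> t + h" "s \<le> \<sigma>" "\<sigma> \<le> s + h" for \<tau> \<sigma>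
    using box[OF that] d1(2)[of "(\<tau>, \<sigma>)"] h by auto
  obtain \<tau> \<sigma> where p: "t \<le> \<tau>" "\<tau> \<le> t + h" "s \<le> \<sigma>" "\<sigma> \<le> s + h"
    "f (t + h) (s + h) - f (t + h) s - f t (s + h) + f t s = h * (h * fxy \<tau> \<sigma>)"
    by (rule mixed_second_differences[OF h(1), of t s f fx fxy]) (use inS fx fxy in auto)
  obtain \<sigma>' \<tau>' where q: "s \<le> \<sigma>'" "\<sigma>' \<le> s + h" "t \<le> \<tau>'" "\<tau>' \<le> t + h"
    "f (t + h) (s + h) - f t (s + h) - f (t + h) s + f t s = h * (h * fyx \<tau>' \<sigma>')"
    by (rule mixed_second_differences[OF h(1), of s t "\<lambda>\<sigma> \<tau>. f \<tau> \<sigma>" "\<lambda>\<sigma> \<tau>. fy \<tau> \<sigma>" "\<lambda>\<sigma> \<tau>. fyx \<tau> \<sigma>"])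
      (use inS fy fyx in auto)
  have "h * (h * fxy \<tau> \<sigma>) = h * (h * fyx \<tau>' \<sigma>')" using p(5) q(5) by linarith
  then have eq: "fxy \<tau> \<sigma> = fyx \<tau>' \<sigma>'" using h(1) by simp
  have "dist (fxy \<tau> \<sigma>) (fxy t s) < e"
    using d1(2)[of "(\<tau>, \<sigma>)"] box[OF p(1-4)] h by auto
  moreover have "dist (fyx \<tau>' \<sigma>') (fyx t s) < e"
    using d2(2)[of "(\<tau>', \<sigma>')"] box[OF q(3,4,1,2)] h by auto
  ultimately have "\<bar>fxy t s - fyx t s\<bar> < 2 * e"
    using eq by (auto simp: dist_real_def)
  then show False by (simp add: e_def)
qed

section \<open>Positivity of the volume form\<close>

text \<open>\<open>2\<^sup>n\<close> times the \<open>n\<close>-fold wedge power of \<open>w\<close>, evaluated on arbitrary vectors.\<close>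

definition form_power ::
  "(complex^'n::finite \<Rightarrow> complex^'n \<Rightarrow> real) \<Rightarrow> ('n \<times> bool \<Rightarrow> complex^'n) \<Rightarrow> real" where
  "form_power w v = (\<Sum>\<sigma> | \<sigma> permutes (UNIV :: ('n \<times> bool) set).
     of_int (sign \<sigma>) * (\<Prod>j\<in>UNIV. w (v (\<sigma> (j, False))) (v (\<sigma> (j, True)))))"

lemma top_power_eq_form_power:
  fixes \<omega> :: "('a, 'n::finite) two_form"
  shows "top_power \<omega> c z = form_power (\<omega> c z) real_basis / 2 ^ CARD('n)"
  by (simp add: top_power_def form_power_def)

text \<open>A choice of two indices for each pair, read as one index function on all of \<open>'n \<times> bool\<close>.\<close>

definition choose_pair :: "('n \<Rightarrow> 'b \<times> 'b) \<Rightarrow> 'n \<times> bool \<Rightarrow> 'b" where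
  "choose_pair g = (\<lambda>(j, y). if y then snd (g j) else fst (g j))"

text \<open>The left side is the Leibniz formula for the matrix whose columns are those of \<open>P\<close> with indices
  \<open>f p\<close>: a repeated column gives zero, a rearrangement gives its sign.\<close>

lemma sum_sign_prod_columns:
  fixes P :: "real^'m^'m::finite"
  shows "(\<Sum>\<sigma> | \<sigma> permutes UNIV. of_int (sign \<sigma>) * (\<Prod>p\<in>UNIV. P $ \<sigma> p $ f p))
    = (if f permutes UNIV then of_int (sign f) * det P else 0)"
proof -
  have "(\<Sum>\<sigma> | \<sigma> permutes UNIV. of_int (sign \<sigma>) * (\<Prod>p\<in>UNIV. P $ \<sigma> p $ f p))
      = det (\<chi> i. transpose P $ f i)"
    by (simp add: det_def transpose_def)
  also have "\<dots> = (if f permutes UNIV then of_int (sign f) * det P else 0)"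
  proof (cases "inj f")
    case True
    then have "f permutes UNIV"
      by (intro bij_imp_permutes) (auto simp: bij_def finite_UNIV_inj_surj)
    then show ?thesis
      by (simp add: det_permute_rows)
  next
    case False
    then obtain i j where "i \<noteq> j" "f i = f j" by (auto simp: inj_def)
    then have "det (\<chi> i. transpose P $ f i) = 0"
      by (intro det_identical_rows[of i j]) (auto simp: row_def vec_eq_iff)
    moreover have "\<not> f permutes UNIV"
      using False permutes_inj by blast
    ultimately show ?thesis by simp
  qed
  finally show ?thesis .
qed

lemma prod_UNIV_Times_bool:
  fixes h :: "'n::finite \<times> bool \<Rightarrow> 'b::comm_monoid_mult"
  shows "(\<Prod>p\<in>UNIV. h p) = (\<Prod>j\<in>UNIV. h (j, False) * h (j, True))"
proof -
  have "(\<Prod>p\<in>UNIV. h p) = (\<Prod>j\<in>UNIV. \<Prod>y\<in>UNIV. h (j, y))"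
    unfolding prod.cartesian_product by simp
  then show ?thesis by (simp add: UNIV_bool)
qed

text \<open>The wedge power is an alternating form in \<open>2n\<close> real vectors, so it scales by the determinant
  of a real change of vectors. Expanding every product bilinearly leaves, for each choice of
  column indices, a Leibniz sum for a matrix whose columns are chosen columns of \<open>P\<close>; only the
  choices that are permutations survive.\<close>

lemma form_power_change_of_basis:
  fixes w :: "complex^'n::finite \<Rightarrow> complex^'n \<Rightarrow> real" and P :: "real^('n \<times> bool)^('n \<times> bool)"
  assumes w: "bilinear w" and v: "\<And>p. v p = (\<Sum>q\<in>UNIV. (P $ p $ q) *\<^sub>R e q)"
  shows "form_power w v = det P * form_power w e"
proof -
  let ?U = "UNIV :: ('n \<Rightarrow> ('n \<times> bool) \<times> ('n \<times> bool)) set"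
  let ?c = "\<lambda>g. \<Prod>j\<in>UNIV. w (e (fst (g j))) (e (snd (g j)))"
  have w2: "w (v p) (v p') = (\<Sum>x\<in>UNIV. (P $ p $ fst x * P $ p' $ snd x) * w (e (fst x)) (e (snd x)))"
    for p p'
    unfolding v bilinear_sum[OF w]
    by (auto simp: bilinear_lmul[OF w] bilinear_rmul[OF w] split_beta intro!: sum.cong)
  have expand: "(\<Prod>j\<in>UNIV. w (v (\<sigma> (j, False))) (v (\<sigma> (j, True))))
      = (\<Sum>g\<in>?U. ?c g * (\<Prod>p\<in>UNIV. P $ \<sigma> p $ choose_pair g p))" for \<sigma>
  proof -
    have "(\<Prod>j\<in>UNIV. w (v (\<sigma> (j, False))) (v (\<sigma> (j, True)))) =
        (\<Sum>g\<in>PiE UNIV (\<lambda>_. UNIV). \<Prod>j\<in>UNIV. (P $ \<sigma> (j, False) $ fst (g j) * P $ \<sigma> (j, True) $ snd (g j))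
          * w (e (fst (g j))) (e (snd (g j))))"
      unfolding w2 by (rule prod_sum_PiE) auto
    then show ?thesis
      by (simp add: PiE_UNIV_domain prod_UNIV_Times_bool choose_pair_def prod.distrib mult_ac)
  qed
  have "form_power w v = (\<Sum>\<sigma> | \<sigma> permutes UNIV. \<Sum>g\<in>?U.
      ?c g * (of_int (sign \<sigma>) * (\<Prod>p\<in>UNIV. P $ \<sigma> p $ choose_pair g p)))"
    unfolding form_power_def expand by (simp add: sum_distrib_left mult_ac)
  also have "\<dots> = (\<Sum>g\<in>?U. ?c g * (\<Sum>\<sigma> | \<sigma> permutes UNIV.
      of_int (sign \<sigma>) * (\<Prod>p\<in>UNIV. P $ \<sigma> p $ choose_pair g p)))"
    by (subst sum.swap) (simp add: sum_distrib_left)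
  also have "\<dots> = (\<Sum>g\<in>?U. if choose_pair g permutes UNIV
      then ?c g * (of_int (sign (choose_pair g)) * det P) else 0)"
    by (intro sum.cong refl) (simp only: sum_sign_prod_columns mult_zero_right split: if_split, simp)
  also have "\<dots> = (\<Sum>g | choose_pair g permutes UNIV. ?c g * (of_int (sign (choose_pair g)) * det P))"
    by (subst sum.inter_filter[symmetric]) auto
  also have "\<dots> = (\<Sum>\<sigma> | \<sigma> permutes UNIV. det P *
      (of_int (sign \<sigma>) * (\<Prod>j\<in>UNIV. w (e (\<sigma> (j, False))) (e (\<sigma> (j, True))))))"
  proof (rule sum.reindex_bij_witness[of _ "\<lambda>\<sigma> j. (\<sigma> (j, False), \<sigma> (j, True))" choose_pair])
    have "choose_pair (\<lambda>j. (\<sigma> (j, False), \<sigma> (j, True))) = \<sigma>" for \<sigma> :: "'n \<times> bool \<Rightarrow> 'n \<times> bool"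
      by (auto simp: choose_pair_def fun_eq_iff)
    then show "\<And>\<sigma>. \<sigma> \<in> {\<sigma>. \<sigma> permutes UNIV} \<Longrightarrow>
        choose_pair (\<lambda>j. (\<sigma> (j, False), \<sigma> (j, True))) = (\<sigma> :: 'n \<times> bool \<Rightarrow> 'n \<times> bool)"
      "\<And>\<sigma>. \<sigma> \<in> {\<sigma>. \<sigma> permutes UNIV} \<Longrightarrow>
        (\<lambda>j. (\<sigma> (j, False), \<sigma> (j, True))) \<in> {g. choose_pair g permutes (UNIV :: ('n \<times> bool) set)}"
      by auto
  qed (auto simp: choose_pair_def mult_ac)
  also have "\<dots> = det P * form_power w e"
    by (simp add: form_power_def sum_distrib_left)
  finally show ?thesis .
qed

lemma sign_map_prod_id:
  fixes \<pi> :: "'n::finite \<Rightarrow> 'n"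
  assumes "\<pi> permutes UNIV"
  shows "sign (map_prod \<pi> (id :: bool \<Rightarrow> bool)) = 1 \<and> map_prod \<pi> (id :: bool \<Rightarrow> bool) permutes UNIV"
  using assms finite_class.finite_UNIV
proof (induction \<pi> rule: permutes_induct)
  case id
  have "map_prod id id = (id :: 'n \<times> bool \<Rightarrow> _)" by (rule map_prod.id)
  then show ?case by (simp only: permutes_id sign_id simp_thms)
next
  case (swap a b p)
  let ?s = "\<lambda>y::bool. Transposition.transpose (a, y) (b, y)"
  have eq: "map_prod (Transposition.transpose a b \<circ> p) id = ?s False \<circ> (?s True \<circ> map_prod p id)"
    by (auto simp: fun_eq_iff Transposition.transpose_def)
  have perm: "permutation (?s y)" for y by (rule permutation_swap_id)
  have p: "permutation (map_prod p (id :: bool \<Rightarrow> bool))"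
    using swap permutes_imp_permutation finite_class.finite_UNIV by blast
  have IH: "sign (map_prod p (id :: bool \<Rightarrow> bool)) = 1" using swap by blast
  have "sign (?s False \<circ> (?s True \<circ> map_prod p id)) = 1"
    unfolding sign_compose[OF perm permutation_compose[OF perm p]] sign_compose[OF perm p] IH
    using swap by (simp add: sign_swap_id)
  moreover have "?s False \<circ> (?s True \<circ> map_prod p id) permutes UNIV"
    using swap by (intro permutes_compose permutes_swap_id) (simp_all del: id_apply)
  ultimately show ?case unfolding eq by blast
qed

definition flip_on :: "'n set \<Rightarrow> 'n \<times> bool \<Rightarrow> 'n \<times> bool" where
  "flip_on S = (\<lambda>(j, y). (j, y \<noteq> (j \<in> S)))"

lemma sign_flip_on:
  fixes S :: "'n::finite set"
  shows "sign (flip_on S) = (- 1) ^ card S \<and> flip_on S permutes UNIV"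
  using finite[of S]
proof (induction S rule: finite_induct)
  case empty
  have "flip_on {} = (id :: 'n \<times> bool \<Rightarrow> _)" by (auto simp: flip_on_def)
  then show ?case by (simp only: permutes_id sign_id card.empty power_0 simp_thms)
next
  case (insert j S)
  have eq: "flip_on (insert j S) = Transposition.transpose (j, False) (j, True) \<circ> flip_on S"
    using insert by (auto simp: flip_on_def fun_eq_iff Transposition.transpose_def)
  have p: "permutation (flip_on S)"
    using insert permutes_imp_permutation finite_class.finite_UNIV by blast
  have "sign (Transposition.transpose (j, False) (j, True) \<circ> flip_on S) = (- 1) ^ card (insert j S)"
    using insert by (simp add: sign_compose permutation_swap_id p sign_swap_id)
  moreover have "Transposition.transpose (j, False) (j, True) \<circ> flip_on S permutes UNIV"
    using insert by (intro permutes_compose permutes_swap_id) auto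
  ultimately show ?case unfolding eq by blast
qed

text \<open>A real 2-form of type \<open>(1,1)\<close> that is positive, on one tangent space.\<close>

definition positive_11 :: "(complex^'n::finite \<Rightarrow> complex^'n \<Rightarrow> real) \<Rightarrow> bool" where
  "positive_11 w \<longleftrightarrow> bilinear w \<and> (\<forall>u v. w u v = - w v u) \<and>
     (\<forall>u v. w (\<i> *s u) (\<i> *s v) = w u v) \<and> (\<forall>u. u \<noteq> 0 \<longrightarrow> w u (\<i> *s u) > 0)"

lemma positive_11D:
  assumes "positive_11 w"
  shows "bilinear w" "w u v = - w v u" "w (\<i> *s u) (\<i> *s v) = w u v"
    "u \<noteq> 0 \<Longrightarrow> w u (\<i> *s u) > 0"
  using assms unfolding positive_11_def by blast+

definition complex_pairs :: "('n \<Rightarrow> complex^'n) \<Rightarrow> 'n \<times> bool \<Rightarrow> complex^'n" where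
  "complex_pairs b = (\<lambda>(j, y). if y then \<i> *s b j else b j)"

text \<open>A permutation contributes to the wedge power on an orthogonal basis only if it maps each pair
  \<open>(b\<^sub>j, i b\<^sub>j)\<close> to such a pair, possibly reversed. Permuting pairs is even, and the sign of each
  reversal is cancelled by the skewness of the form, so all contributions are positive.\<close>

lemma form_power_orthogonal_pos:
  assumes w: "positive_11 w"
    and nz: "\<And>j. b j \<noteq> 0"
    and orth: "\<And>j k. j \<noteq> k \<Longrightarrow> w (b j) (b k) = 0 \<and> w (b j) (\<i> *s b k) = 0"
  shows "form_power w (complex_pairs b) > 0"
proof -
  let ?v = "complex_pairs b"
  define a where "a j = w (b j) (\<i> *s b j)" for j
  have a: "a j > 0" for j using positive_11D(4)[OF w nz] by (simp add: a_def)
  note skew = positive_11D(2)[OF w] and J = positive_11D(3)[OF w]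
  have self: "w u u = 0" for u using skew[of u u] by simp
  have val: "w (?v p) (?v q) = (if fst p = fst q \<and> snd p \<noteq> snd q
      then (if snd q then a (fst p) else - a (fst p)) else 0)" for p q
  proof (cases p, cases q)
    fix j y k y' assume "p = (j, y)" "q = (k, y')"
    then show ?thesis
      using orth[of j k] orth[of k j] skew[of "\<i> *s b j" "b k"]
      by (cases "j = k") (auto simp: complex_pairs_def J self a_def)
  qed
  have nonneg: "0 \<le> of_int (sign \<sigma>) * (\<Prod>j\<in>UNIV. w (?v (\<sigma> (j, False))) (?v (\<sigma> (j, True))))"
    if \<sigma>: "\<sigma> permutes UNIV" for \<sigma>
  proof (cases "\<forall>j. fst (\<sigma> (j, False)) = fst (\<sigma> (j, True)) \<and> snd (\<sigma> (j, False)) \<noteq> snd (\<sigma> (j, True))")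
    case False
    then obtain j where "\<not> (fst (\<sigma> (j, False)) = fst (\<sigma> (j, True)) \<and> snd (\<sigma> (j, False)) \<noteq> snd (\<sigma> (j, True)))"
      by blast
    then have "w (?v (\<sigma> (j, False))) (?v (\<sigma> (j, True))) = 0" by (simp only: val if_False)
    then have "(\<Prod>j\<in>UNIV. w (?v (\<sigma> (j, False))) (?v (\<sigma> (j, True)))) = 0"
      by (intro prod_zero) auto
    then show ?thesis by (simp only: mult_zero_right order_refl)
  next
    case True
    define \<pi> where "\<pi> j = fst (\<sigma> (j, False))" for j
    define S where "S = {j. snd (\<sigma> (j, False))}"
    have \<sigma>_eq: "\<sigma> (j, y) = (\<pi> j, y \<noteq> (j \<in> S))" for j y
      using True by (cases y) (auto simp: \<pi>_def S_def prod_eq_iff)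
    have inj\<sigma>: "inj \<sigma>" using \<sigma> permutes_inj by blast
    have "inj \<pi>"
    proof (rule injI)
      fix j k assume "\<pi> j = \<pi> k"
      then have "\<sigma> (j, j \<in> S) = \<sigma> (k, k \<in> S)" by (simp add: \<sigma>_eq)
      then show "j = k" using inj\<sigma> by (simp add: inj_eq)
    qed
    then have \<pi>: "\<pi> permutes UNIV"
      by (intro bij_imp_permutes) (auto simp: bij_def finite_UNIV_inj_surj)
    have "\<sigma> = map_prod \<pi> id \<circ> flip_on S"
      by (auto simp: fun_eq_iff \<sigma>_eq flip_on_def)
    moreover have "permutation (map_prod \<pi> (id :: bool \<Rightarrow> bool))" "permutation (flip_on S)"
      using sign_map_prod_id[OF \<pi>] sign_flip_on[of S] permutes_imp_permutation finite_class.finite_UNIV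
      by blast+
    ultimately have sgn: "sign \<sigma> = (- 1) ^ card S"
      using sign_map_prod_id[OF \<pi>] sign_flip_on[of S] by (simp add: sign_compose)
    have "(\<Prod>j\<in>UNIV. w (?v (\<sigma> (j, False))) (?v (\<sigma> (j, True))))
        = (\<Prod>j\<in>UNIV. (if j \<in> S then - 1 else 1) * a (\<pi> j))"
      by (intro prod.cong) (auto simp: val \<sigma>_eq)
    also have "\<dots> = (- 1) ^ card S * (\<Prod>j\<in>UNIV. a (\<pi> j))"
      by (simp add: prod.distrib prod.If_cases)
    finally have "of_int (sign \<sigma>) * (\<Prod>j\<in>UNIV. w (?v (\<sigma> (j, False))) (?v (\<sigma> (j, True))))
        = (\<Prod>j\<in>UNIV. a (\<pi> j))"
      by (simp add: sgn flip: mult.assoc power_mult_distrib)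
    also have "\<dots> \<ge> 0" using a by (intro prod_nonneg) (simp add: less_imp_le)
    finally show ?thesis .
  qed
  have "0 < of_int (sign id) * (\<Prod>j\<in>UNIV. w (?v (id (j, False))) (?v (id (j, True))))"
    using a by (simp add: val sign_id prod_pos)
  then show ?thesis
    unfolding form_power_def
    by (intro sum_pos2[of _ id]) (use nonneg permutes_id in \<open>auto simp del: id_apply\<close>)
qed

text \<open>Gram-Schmidt: the vectors complex orthogonal to \<open>b\<^sub>k\<close> for \<open>k\<close> in a proper subset of the index set
  form the kernel of a non-surjective endomorphism, which is nonzero.\<close>

lemma orthogonal_system_exists:
  fixes w :: "complex^'n::finite \<Rightarrow> complex^'n \<Rightarrow> real"
  assumes w: "positive_11 w"
  shows "\<exists>b :: 'n \<Rightarrow> complex^'n. (\<forall>j\<in>S. b j \<noteq> 0) \<and>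
    (\<forall>j\<in>S. \<forall>k\<in>S. j \<noteq> k \<longrightarrow> w (b j) (b k) = 0 \<and> w (b j) (\<i> *s b k) = 0)"
  using finite[of S]
proof (induction S rule: finite_induct)
  case empty
  then show ?case by simp
next
  case (insert j S)
  from insert.IH obtain b where b: "\<forall>j\<in>S. b j \<noteq> 0"
    "\<forall>j\<in>S. \<forall>k\<in>S. j \<noteq> k \<longrightarrow> w (b j) (b k) = 0 \<and> w (b j) (\<i> *s b k) = 0"
    by (elim exE conjE)
  note bil = positive_11D(1)[OF w] and skew = positive_11D(2)[OF w] and J = positive_11D(3)[OF w]
  define T :: "complex^'n \<Rightarrow> complex^'n" where
    "T u = (\<chi> k. if k \<in> S then Complex (w u (b k)) (w u (\<i> *s b k)) else 0)" for u
  have lin: "linear T"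
    by (rule linearI)
      (auto simp: T_def vec_eq_iff complex_eq_iff bilinear_ladd[OF bil] bilinear_lmul[OF bil])
  (* The component with index j of every value of T is zero, because j is not in S. *)
  have "T u \<noteq> axis j 1" for u
    using insert(2) by (auto simp: T_def vec_eq_iff axis_def intro!: exI[of _ j])
  then have "\<not> surj T" by (metis surjD)
  then have "\<not> inj T" using linear_injective_imp_surjective[OF lin] by blast
  then obtain u where u: "u \<noteq> 0" "T u = 0" using linear_injective_0[OF lin] by blast
  have uS: "w u (b k) = 0" "w u (\<i> *s b k) = 0" if "k \<in> S" for k
    using u(2) that by (auto simp: T_def vec_eq_iff complex_eq_iff dest: spec[of _ k])
  have Su: "w (b k) u = 0" "w (b k) (\<i> *s u) = 0" if "k \<in> S" for k
  proof -
    show "w (b k) u = 0" using skew[of "b k" u] uS(1)[OF that] by simp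
    have "\<i> *s (\<i> *s b k) = - b k" by (simp add: vec_eq_iff)
    then have "w u (\<i> *s b k) = - w (\<i> *s u) (b k)"
      using J[of u "\<i> *s b k"] bilinear_rneg[OF bil, of "\<i> *s u" "b k"] by simp
    then show "w (b k) (\<i> *s u) = 0"
      using skew[of "b k" "\<i> *s u"] uS(2)[OF that] by simp
  qed
  show ?case
    by (rule exI[of _ "b(j := u)"]) (use b u uS Su insert(2) in auto)
qed

definition real_coords :: "complex^'n \<Rightarrow> 'n \<times> bool \<Rightarrow> real" where
  "real_coords u = (\<lambda>(j, y). if y then Im (u $ j) else Re (u $ j))"

lemma real_basis_expansion:
  fixes u :: "complex^'n::finite"
  shows "u = (\<Sum>q\<in>UNIV. real_coords u q *\<^sub>R real_basis q)"
proof -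
  have "(\<Sum>q\<in>UNIV. real_coords u q *\<^sub>R real_basis q)
      = (\<Sum>j\<in>UNIV. \<Sum>y\<in>UNIV. real_coords u (j, y) *\<^sub>R (real_basis (j, y) :: complex^'n))"
    unfolding sum.cartesian_product by simp
  also have "\<dots> = u"
    by (auto simp: UNIV_bool real_coords_def real_basis_def vec_eq_iff axis_def sum.distrib
        complex_eq_iff if_distrib cong: if_cong)
  finally show ?thesis by simp
qed

lemma form_power_real_basis_nonzero:
  fixes w :: "complex^'n::finite \<Rightarrow> complex^'n \<Rightarrow> real"
  assumes w: "positive_11 w"
  shows "form_power w real_basis \<noteq> 0"
proof -
  obtain b :: "'n \<Rightarrow> complex^'n" where b: "\<And>j. b j \<noteq> 0"
    "\<And>j k. j \<noteq> k \<Longrightarrow> w (b j) (b k) = 0 \<and> w (b j) (\<i> *s b k) = 0"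
    using orthogonal_system_exists[OF w, of UNIV] by auto
  have "form_power w (complex_pairs b) =
      det (\<chi> p q. real_coords (complex_pairs b p) q) * form_power w real_basis"
    by (rule form_power_change_of_basis[OF positive_11D(1)[OF w]]) (simp, rule real_basis_expansion)
  moreover have "form_power w (complex_pairs b) > 0"
    by (rule form_power_orthogonal_pos[OF w]) (use b in auto)
  ultimately show ?thesis by auto
qed

definition standard_form :: "complex^'n::finite \<Rightarrow> complex^'n \<Rightarrow> real" where
  "standard_form u v = (\<Sum>k\<in>UNIV. Re (u $ k) * Im (v $ k) - Im (u $ k) * Re (v $ k))"

lemma positive_11_standard_form: "positive_11 (standard_form :: complex^'n::finite \<Rightarrow> _)"
  unfolding positive_11_def
proof (intro conjI allI impI)
  show "bilinear (standard_form :: complex^'n \<Rightarrow> _)"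
    unfolding bilinear_def standard_form_def
    by (auto intro!: linearI simp: sum.distrib[symmetric] sum_distrib_left algebra_simps
        intro!: sum.cong)
  show "standard_form u v = - standard_form v u" for u v :: "complex^'n"
    by (simp add: standard_form_def sum_negf[symmetric] algebra_simps)
  show "standard_form (\<i> *s u) (\<i> *s v) = standard_form u v" for u v :: "complex^'n"
    by (simp add: standard_form_def algebra_simps)
  fix u :: "complex^'n" assume "u \<noteq> 0"
  then obtain k where k: "u $ k \<noteq> 0" by (auto simp: vec_eq_iff)
  have "standard_form u (\<i> *s u) = (\<Sum>k\<in>UNIV. (Re (u $ k))\<^sup>2 + (Im (u $ k))\<^sup>2)"
    by (simp add: standard_form_def power2_eq_square)
  also have "\<dots> > 0"
    using k by (intro sum_pos2[of _ k]) (auto simp: complex_eq_iff sum_power2_gt_zero_iff)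
  finally show "standard_form u (\<i> *s u) > 0" .
qed

lemma form_power_standard_form_pos:
  "form_power (standard_form :: complex^'n::finite \<Rightarrow> _) real_basis > 0"
proof -
  have eq: "real_basis = complex_pairs (\<lambda>j::'n. axis j 1)"
    by (auto simp: real_basis_def complex_pairs_def fun_eq_iff vec_eq_iff axis_def)
  have "form_power standard_form (complex_pairs (\<lambda>j::'n. axis j 1)) > 0"
  proof (rule form_power_orthogonal_pos[OF positive_11_standard_form])
    show "axis j 1 \<noteq> (0 :: complex^'n)" for j by (simp add: axis_eq_0_iff)
    show "standard_form (axis j 1 :: complex^'n) (axis k 1) = 0 \<and>
        standard_form (axis j 1 :: complex^'n) (\<i> *s axis k 1) = 0" if "j \<noteq> k" for j k
      using that by (auto simp: standard_form_def axis_def intro!: sum.neutral)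
  qed
  then show ?thesis by (simp add: eq)
qed

text \<open>On the standard basis the wedge power of a positive form is nonzero, because it is nonzero on
  a complex orthogonal basis. Its sign is constant along the segment from the standard form.\<close>

lemma form_power_real_basis_pos:
  fixes w :: "complex^'n::finite \<Rightarrow> complex^'n \<Rightarrow> real"
  assumes w: "positive_11 w"
  shows "form_power w real_basis > 0"
proof (rule ccontr)
  assume neg: "\<not> form_power w real_basis > 0"
  define ws where "ws s u v = (1 - s) * standard_form u v + s * w u v"
    for s and u v :: "complex^'n"
  note w0 = positive_11_standard_form[where 'n = 'n]
  have pos: "positive_11 (ws s)" if "0 \<le> s" "s \<le> 1" for s
    unfolding positive_11_def
  proof (intro conjI allI impI)
    note b = positive_11D(1)[OF w0] positive_11D(1)[OF w]
    show "bilinear (ws s)"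
      unfolding bilinear_def ws_def
      by (auto intro!: linearI simp: bilinear_ladd[OF b(1)] bilinear_ladd[OF b(2)]
          bilinear_lmul[OF b(1)] bilinear_lmul[OF b(2)] bilinear_radd[OF b(1)] bilinear_radd[OF b(2)]
          bilinear_rmul[OF b(1)] bilinear_rmul[OF b(2)] algebra_simps)
    show "ws s u v = - ws s v u" for u v
      unfolding ws_def positive_11D(2)[OF w0, of u v] positive_11D(2)[OF w, of u v] by simp
    show "ws s (\<i> *s u) (\<i> *s v) = ws s u v" for u v
      by (simp add: ws_def positive_11D(3)[OF w0] positive_11D(3)[OF w])
    fix u :: "complex^'n" assume u: "u \<noteq> 0"
    note p = positive_11D(4)[OF w0 u] positive_11D(4)[OF w u]
    show "ws s u (\<i> *s u) > 0"
    proof (cases "s = 1")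
      case False
      then show ?thesis unfolding ws_def using p that
        by (intro add_pos_nonneg mult_pos_pos mult_nonneg_nonneg) auto
    qed (use p in \<open>simp add: ws_def\<close>)
  qed
  have cont: "continuous_on {0..1} (\<lambda>s. form_power (ws s) real_basis)"
    unfolding form_power_def ws_def by (intro continuous_intros)
  have ends: "ws 0 = standard_form" "ws 1 = w" by (auto simp: ws_def fun_eq_iff)
  have "\<exists>s\<ge>0. s \<le> 1 \<and> form_power (ws s) real_basis = 0"
    by (rule IVT2'[OF _ _ _ cont]) (use neg form_power_standard_form_pos[where 'n = 'n] in \<open>simp_all add: ends\<close>)
  then show False using pos form_power_real_basis_nonzero by blast
qed

lemma top_power_pos:
  assumes "kaehler_manifold A \<omega>" "c \<in> A" "z \<in> coord_image c"
  shows "top_power \<omega> c z > 0"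
proof -
  have "positive_11 (\<omega> c z)"
    using assms unfolding positive_11_def kaehler_manifold_def kaehler_form_def smooth_two_form_def
    by blast
  from form_power_real_basis_pos[OF this] show ?thesis
    by (simp add: top_power_eq_form_power)
qed

lemma top_power_continuous_on:
  assumes "kaehler_manifold A \<omega>" "c \<in> A"
  shows "continuous_on (coord_image c) (top_power \<omega> c)"
proof -
  have "C_infty_on (coord_image c) (\<lambda>z. \<omega> c z u v)" for u v
    using assms unfolding kaehler_manifold_def kaehler_form_def smooth_two_form_def by blast
  then have "continuous_on (coord_image c) (\<lambda>z. \<omega> c z u v)" for u v
    by (rule C_infty_on_imp_continuous_on)
  then show ?thesis
    unfolding top_power_def by (intro continuous_intros) auto
qed

section \<open>Integration over the manifold\<close>

text \<open>Urysohn's lemma separates \<open>x\<close> from the complement of \<open>U\<close>; cutting the function off at half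
  of its height moves the closure of the support inside \<open>U\<close>.\<close>

lemma compact_t2_bump:
  fixes U :: "'a::t2_space set"
  assumes "compact (UNIV :: 'a set)" "open U" "x \<in> U"
  obtains u :: "'a \<Rightarrow> real" where "continuous_on UNIV u" "\<And>y. 0 \<le> u y" "u x > 0"
    "closure {y. u y \<noteq> 0} \<subseteq> U"
proof -
  have haus: "Hausdorff_space (euclidean :: 'a topology)"
    unfolding Hausdorff_space_def using hausdorff by (fastforce simp: disjnt_def)
  have "compact_space (euclidean :: 'a topology)"
    using assms(1) by (simp add: compact_space_def)
  then have "completely_regular_space (euclidean :: 'a topology)"
    using haus compact_Hausdorff_or_regular_imp_normal_space normal_imp_completely_regular_space by blast
  then have "closedin euclidean (- U) \<and> x \<in> topspace euclidean - (- U) \<longrightarrow>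
      (\<exists>f::'a \<Rightarrow> real. continuous_map euclidean (top_of_set {0..1}) f \<and> f x = 0 \<and> f ` (- U) \<subseteq> {1})"
    unfolding completely_regular_space_def by blast
  then obtain f :: "'a \<Rightarrow> real" where f: "continuous_map euclidean (top_of_set {0..1}) f"
    "f x = 0" "f ` (- U) \<subseteq> {1}"
    using assms by auto
  have cont: "continuous_on UNIV f"
    using f(1) by (simp add: continuous_map_in_subtopology)
  define u where "u y = max 0 (1 / 2 - f y)" for y
  have "closed {y. f y \<le> 1 / 2}"
    using cont by (intro closed_Collect_le continuous_on_const)
  moreover have "{y. u y \<noteq> 0} \<subseteq> {y. f y \<le> 1 / 2}"
    by (auto simp: u_def)
  ultimately have "closure {y. u y \<noteq> 0} \<subseteq> {y. f y \<le> 1 / 2}"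
    by (rule closure_minimal[rotated])
  also have "\<dots> \<subseteq> U" using f(3) by force
  finally have "closure {y. u y \<noteq> 0} \<subseteq> U" .
  moreover have "continuous_on UNIV u"
    unfolding u_def using cont by (intro continuous_intros)
  ultimately show thesis
    by (intro that[of u]) (auto simp: u_def f(2))
qed

text \<open>The integral is formed with an arbitrarily selected partition of unity, so it has its meaning
  only because there is one. Bump functions inside charts are collected chart by chart and divided
  by their total.\<close>

lemma partition_of_unity_exists:
  fixes A :: "('a::t2_space, 'n::finite) chart set"
  assumes "compact (UNIV :: 'a set)" "complex_atlas A"
  shows "\<exists>Cp. partition_of_unity A Cp"
proof -
  have "\<forall>x. \<exists>c\<in>A. x \<in> fst c" and op: "\<And>c. c \<in> A \<Longrightarrow> open (fst c)"
    using assms(2) by (auto simp: complex_atlas_def)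
  then obtain ch where ch: "\<And>x. ch x \<in> A" "\<And>x. x \<in> fst (ch x)" by metis
  have "\<exists>u :: 'a \<Rightarrow> real. continuous_on UNIV u \<and> (\<forall>y. 0 \<le> u y) \<and> u x > 0 \<and>
      closure {y. u y \<noteq> 0} \<subseteq> fst (ch x)" for x
    by (rule compact_t2_bump[OF assms(1) op[OF ch(1)] ch(2)[of x]]) blast
  then obtain u :: "'a \<Rightarrow> 'a \<Rightarrow> real" where u: "\<And>x. continuous_on UNIV (u x)"
    "\<And>x y. 0 \<le> u x y" "\<And>x. u x x > 0" "\<And>x. closure {y. u x y \<noteq> 0} \<subseteq> fst (ch x)"
    by metis
  have opU: "open {y. u x y > 0}" for x
    using u(1) by (intro open_Collect_less continuous_on_const)
  obtain X where X: "finite X" "UNIV \<subseteq> (\<Union>x\<in>X. {y. u x y > 0})"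
    by (rule compactE_image[OF assms(1), of UNIV "\<lambda>x. {y. u x y > 0}"]) (use opU u(3) in auto)
  define C where "C = ch ` X"
  define s where "s y = (\<Sum>x\<in>X. u x y)" for y
  define p where "p c y = (\<Sum>x | x \<in> X \<and> ch x = c. u x y) / s y" for c y
  have s_pos: "s y > 0" for y
  proof -
    obtain x where "x \<in> X" "u x y > 0" using X(2) by auto
    then show ?thesis using X(1) u(2) unfolding s_def by (intro sum_pos2) auto
  qed
  have "partition_of_unity A (C, p)"
    unfolding partition_of_unity_def prod.case
  proof (intro conjI ballI allI)
    show "finite C" "C \<subseteq> A" using X ch by (auto simp: C_def)
    fix c assume "c \<in> C"
    show "continuous_on UNIV (p c)"
      unfolding p_def s_def
      by (intro continuous_on_divide continuous_on_sum u(1)) (metis s_pos s_def less_irrefl)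
    show "0 \<le> p c y" for y
      unfolding p_def using s_pos u(2) by (intro divide_nonneg_pos sum_nonneg) auto
    have "{y. p c y \<noteq> 0} \<subseteq> (\<Union>x\<in>{x \<in> X. ch x = c}. closure {y. u x y \<noteq> 0})"
    proof
      fix y assume "y \<in> {y. p c y \<noteq> 0}"
      then have "(\<Sum>x | x \<in> X \<and> ch x = c. u x y) \<noteq> 0" by (auto simp: p_def)
      then obtain x where "x \<in> {x \<in> X. ch x = c}" "u x y \<noteq> 0"
        by (rule sum.not_neutral_contains_not_neutral)
      then show "y \<in> (\<Union>x\<in>{x \<in> X. ch x = c}. closure {y. u x y \<noteq> 0})"
        using closure_subset[of "{y. u x y \<noteq> 0}"] by blast
    qed
    moreover have "closed (\<Union>x\<in>{x \<in> X. ch x = c}. closure {y. u x y \<noteq> 0})"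
      using X by (intro closed_UN) auto
    ultimately have "closure {y. p c y \<noteq> 0} \<subseteq> (\<Union>x\<in>{x \<in> X. ch x = c}. closure {y. u x y \<noteq> 0})"
      by (rule closure_minimal)
    then show "closure {y. p c y \<noteq> 0} \<subseteq> fst c" using u(4) by fastforce
  next
    fix y
    have "(\<Sum>c\<in>C. p c y) = (\<Sum>c\<in>ch ` X. \<Sum>x | x \<in> X \<and> ch x = c. u x y) / s y"
      by (simp add: p_def C_def sum_divide_distrib)
    also have "\<dots> = 1"
      using sum.image_gen[OF X(1), of "\<lambda>x. u x y" ch, symmetric] s_pos[of y] by (simp add: s_def)
    finally show "(\<Sum>c\<in>C. p c y) = 1" .
  qed
  then show ?thesis by blast
qed

lemma set_integral_pos_of_continuous:
  fixes h :: "'b::euclidean_space \<Rightarrow> real"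
  assumes "open S" "continuous_on S h" "set_integrable lborel S h"
    and "\<And>z. z \<in> S \<Longrightarrow> h z \<ge> 0" and "z0 \<in> S" "h z0 > 0"
  shows "(LINT z:S|lborel. h z) > 0"
proof -
  have "open (S \<inter> h -` {h z0 / 2 <..})"
    using assms(1,2) by (simp add: continuous_open_preimage)
  then obtain r where r: "r > 0" "ball z0 r \<subseteq> S \<inter> h -` {h z0 / 2 <..}"
    using assms(5,6) openE[of "S \<inter> h -` {h z0 / 2 <..}" z0] by auto
  have "0 < h z0 / 2 * measure lborel (ball z0 r)"
    using content_ball_pos[OF r(1), of z0] assms(6) by simp
  also have "\<dots> = (LINT z|lborel. h z0 / 2 * indicator (ball z0 r) z)"
    by simp
  also have "\<dots> \<le> (LINT z|lborel. indicator S z *\<^sub>R h z)"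
  proof (rule integral_mono)
    show "integrable lborel (\<lambda>z. h z0 / 2 * indicator (ball z0 r) z)"
      using emeasure_lborel_ball_finite[of z0 r] by (intro integrable_mult_right integrable_real_indicator) auto
    show "integrable lborel (\<lambda>z. indicator S z *\<^sub>R h z)"
      using assms(3) by (simp add: set_integrable_def)
    show "h z0 / 2 * indicator (ball z0 r) z \<le> indicator S z *\<^sub>R h z" for z
      using r(2) assms(4)[of z] by (auto simp: indicator_def)
  qed
  finally show ?thesis by (simp add: set_lebesgue_integral_def)
qed

locale compact_kaehler =
  fixes A :: "('a::t2_space, 'n::finite) chart set" and \<omega> :: "('a, 'n) two_form"
  assumes kaehler: "kaehler_manifold A \<omega>" and compact_M: "compact (UNIV :: 'a set)"
begin

abbreviation vol :: "('a \<Rightarrow> real) \<Rightarrow> real" where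
  "vol \<equiv> integral_vol A \<omega>"

lemma atlas: "complex_atlas A"
  using kaehler by (simp add: kaehler_manifold_def)

lemma chart:
  assumes "c \<in> A"
  shows "open (fst c)" "open (coord_image c)"
    "continuous_on (fst c) (snd c)" "continuous_on (coord_image c) (param c)"
    "\<And>x. x \<in> fst c \<Longrightarrow> snd c x \<in> coord_image c \<and> param c (snd c x) = x"
    "\<And>z. z \<in> coord_image c \<Longrightarrow> param c z \<in> fst c \<and> snd c (param c z) = z"
proof -
  show "open (fst c)" "open (coord_image c)"
    using atlas assms unfolding complex_atlas_def by blast+
  have h: "homeomorphism (fst c) (coord_image c) (snd c) (param c)"
    using atlas assms unfolding complex_atlas_def by blast
  show "continuous_on (fst c) (snd c)" "continuous_on (coord_image c) (param c)"
    using h homeomorphism_cont1 homeomorphism_cont2 by blast+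
  show "snd c x \<in> coord_image c \<and> param c (snd c x) = x" if "x \<in> fst c" for x
    using homeomorphism_apply1[OF h that] homeomorphism_image1[OF h] that by blast
  show "param c z \<in> fst c \<and> snd c (param c z) = z" if "z \<in> coord_image c" for z
    using homeomorphism_apply2[OF h that] homeomorphism_image2[OF h] that by blast
qed

lemma chart_exists: obtains c where "c \<in> A" "x \<in> fst c"
  using atlas unfolding complex_atlas_def by blast

definition pou where "pou = (SOME Cp. partition_of_unity A Cp)"

text \<open>The weight against which the coordinate expression of a function is integrated in a chart.\<close>

definition chart_density :: "('a, 'n) chart \<Rightarrow> complex^'n \<Rightarrow> real" where
  "chart_density c z = snd pou c (param c z) * top_power \<omega> c z"

lemma pou:
  "finite (fst pou)" "fst pou \<subseteq> A"
  "c \<in> fst pou \<Longrightarrow> continuous_on UNIV (snd pou c)"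
  "c \<in> fst pou \<Longrightarrow> 0 \<le> snd pou c x"
  "c \<in> fst pou \<Longrightarrow> closure {x. snd pou c x \<noteq> 0} \<subseteq> fst c"
  "(\<Sum>c\<in>fst pou. snd pou c x) = 1"
proof -
  have "partition_of_unity A pou"
    unfolding pou_def using partition_of_unity_exists[OF compact_M atlas] by (rule someI_ex)
  then show "finite (fst pou)" "fst pou \<subseteq> A"
  "c \<in> fst pou \<Longrightarrow> continuous_on UNIV (snd pou c)"
  "c \<in> fst pou \<Longrightarrow> 0 \<le> snd pou c x"
  "c \<in> fst pou \<Longrightarrow> closure {x. snd pou c x \<noteq> 0} \<subseteq> fst c"
  "(\<Sum>c\<in>fst pou. snd pou c x) = 1"
    by (auto simp: partition_of_unity_def split_beta)
qed

lemma vol_eq: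
  "vol f = (\<Sum>c\<in>fst pou. LINT z:coord_image c|lborel. f (param c z) * chart_density c z) / fact CARD('n)"
  unfolding integral_vol_def integral_omega_n_def pou_def[symmetric] chart_density_def
  by (simp add: split_beta mult_ac)

lemma integral_omega_n_eq: "integral_omega_n A \<omega> f = fact CARD('n) * vol f"
  by (simp add: integral_vol_def)

lemma integrand_continuous_on:
  assumes "continuous_on UNIV f" "c \<in> fst pou"
  shows "continuous_on (coord_image c) (\<lambda>z. f (param c z) * chart_density c z)"
proof -
  have c: "c \<in> A" using assms(2) pou(2) by blast
  have "continuous_on (coord_image c) (\<lambda>z. g (param c z))" if "continuous_on UNIV g" for g :: "'a \<Rightarrow> real"
    by (rule continuous_on_compose2[OF that chart(4)[OF c]]) simp
  then show ?thesis
    unfolding chart_density_def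
    by (intro continuous_on_mult top_power_continuous_on[OF kaehler c]) (use assms pou(3) in blast)+
qed

lemma chart_density_nonneg: "c \<in> fst pou \<Longrightarrow> z \<in> coord_image c \<Longrightarrow> 0 \<le> chart_density c z"
  unfolding chart_density_def using pou(4) top_power_pos[OF kaehler subsetD[OF pou(2)], of c z]
  by (intro mult_nonneg_nonneg) (simp_all add: less_imp_le)

text \<open>The coordinate image need not be bounded and the coefficient of the form may blow up at its
  boundary, but the weight vanishes off the compact image of the support of the partition
  function.\<close>

lemma integrand_set_integrable:
  assumes f: "continuous_on UNIV f" and c: "c \<in> fst pou"
  shows "set_integrable lborel (coord_image c) (\<lambda>z. f (param c z) * chart_density c z)"
proof -
  have cA: "c \<in> A" using c pou(2) by blast
  define K where "K = snd c ` closure {x. snd pou c x \<noteq> 0}"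
  have "compact (closure {x. snd pou c x \<noteq> 0})"
    using compact_Int_closed[OF compact_M closed_closure] by simp
  then have "compact K"
    unfolding K_def using chart(3)[OF cA] pou(5)[OF c]
    by (intro compact_continuous_image) (auto intro: continuous_on_subset)
  moreover have K: "K \<subseteq> coord_image c"
    unfolding K_def coord_image_def using pou(5)[OF c] by auto
  ultimately have int: "integrable lborel (\<lambda>z. indicator K z *\<^sub>R (f (param c z) * chart_density c z))"
    using continuous_on_subset[OF integrand_continuous_on[OF f c]] by (intro borel_integrable_compact)
  have "chart_density c z = 0" if z: "z \<in> coord_image c" "z \<notin> K" for z
  proof -
    have "z = snd c (param c z)" using chart(6)[OF cA z(1)] by simp
    then have "param c z \<notin> closure {x. snd pou c x \<noteq> 0}" using z(2) unfolding K_def by blast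
    then have "snd pou c (param c z) = 0"
      using closure_subset[of "{x. snd pou c x \<noteq> 0}"] by blast
    then show ?thesis by (simp add: chart_density_def)
  qed
  then have "(\<lambda>z. indicator K z *\<^sub>R (f (param c z) * chart_density c z)) =
      (\<lambda>z. indicator (coord_image c) z *\<^sub>R (f (param c z) * chart_density c z))"
    using K by (auto simp: fun_eq_iff indicator_def)
  then show ?thesis using int by (simp add: set_integrable_def)
qed

lemma vol_add:
  assumes "continuous_on UNIV f" "continuous_on UNIV g"
  shows "vol (\<lambda>x. f x + g x) = vol f + vol g"
proof -
  have "(LINT z:coord_image c|lborel. (f (param c z) + g (param c z)) * chart_density c z)
      = (LINT z:coord_image c|lborel. f (param c z) * chart_density c z)
      + (LINT z:coord_image c|lborel. g (param c z) * chart_density c z)" if "c \<in> fst pou" for c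
    unfolding distrib_right using that assms by (intro set_integral_add integrand_set_integrable)
  then show ?thesis by (simp add: vol_eq sum.distrib add_divide_distrib)
qed

lemma vol_cmult: "vol (\<lambda>x. r * f x) = r * vol f"
  by (simp add: vol_eq mult.assoc sum_distrib_left)

lemma vol_minus: "vol (\<lambda>x. - f x) = - vol f"
  using vol_cmult[of "- 1" f] by simp

lemma vol_diff:
  assumes "continuous_on UNIV f" "continuous_on UNIV g"
  shows "vol (\<lambda>x. f x - g x) = vol f - vol g"
  using vol_add[OF assms(1) continuous_on_minus[OF assms(2)]] by (simp add: vol_minus)

lemma vol_nonneg:
  assumes "\<And>x. 0 \<le> f x"
  shows "0 \<le> vol f"
proof -
  have "0 \<le> (LINT z:coord_image c|lborel. f (param c z) * chart_density c z)" if "c \<in> fst pou" for c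
    unfolding set_lebesgue_integral_def using assms chart_density_nonneg[OF that]
    by (intro Bochner_Integration.integral_nonneg) (auto simp: indicator_def)
  then show ?thesis unfolding vol_eq by (intro divide_nonneg_pos sum_nonneg) auto
qed

text \<open>At every point some partition function is positive, and so is the coefficient of \<open>\<omega>\<^sup>n\<close>.\<close>

lemma vol_pos:
  assumes f: "continuous_on UNIV f" "\<And>x. 0 \<le> f x" and x0: "f x0 > 0"
  shows "0 < vol f"
proof -
  have "(\<Sum>c\<in>fst pou. snd pou c x0) \<noteq> 0" using pou(6) by simp
  then obtain c where c: "c \<in> fst pou" "snd pou c x0 \<noteq> 0"
    by (rule sum.not_neutral_contains_not_neutral)
  have cA: "c \<in> A" using c pou(2) by blast
  have "x0 \<in> closure {x. snd pou c x \<noteq> 0}"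
    using c(2) closure_subset[of "{x. snd pou c x \<noteq> 0}"] by blast
  then have x0c: "x0 \<in> fst c" using pou(5)[OF c(1)] by blast
  note z0 = chart(5)[OF cA x0c]
  have ge: "0 \<le> (LINT z:coord_image c|lborel. f (param c z) * chart_density c z)" if "c \<in> fst pou" for c
    unfolding set_lebesgue_integral_def using f(2) chart_density_nonneg[OF that]
    by (intro Bochner_Integration.integral_nonneg) (auto simp: indicator_def)
  have "snd pou c x0 > 0" using pou(4)[OF c(1), of x0] c(2) by simp
  then have d: "chart_density c (snd c x0) > 0"
    using z0 top_power_pos[OF kaehler cA, of "snd c x0"] by (simp add: chart_density_def)
  have "0 < (LINT z:coord_image c|lborel. f (param c z) * chart_density c z)"
    by (rule set_integral_pos_of_continuous[of _ _ "snd c x0"])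
      (use chart(2)[OF cA] integrand_continuous_on[OF f(1) c(1)] integrand_set_integrable[OF f(1) c(1)]
        f(2) chart_density_nonneg[OF c(1)] z0 x0 d in auto)
  then have "0 < (\<Sum>c\<in>fst pou. LINT z:coord_image c|lborel. f (param c z) * chart_density c z)"
    using ge pou(1) c(1) by (intro sum_pos2) auto
  then show ?thesis unfolding vol_eq by simp
qed

lemma vol_mono:
  assumes "continuous_on UNIV f" "continuous_on UNIV g" "\<And>x. f x \<le> g x"
  shows "vol f \<le> vol g"
proof -
  have "0 \<le> vol (\<lambda>x. g x - f x)" using assms(3) by (intro vol_nonneg) simp
  then show ?thesis using vol_diff[OF assms(2,1)] by simp
qed

lemma vol_one_pos: "0 < vol (\<lambda>_. 1)"
  by (rule vol_pos) auto

lemma vol_abs_le: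
  assumes "continuous_on UNIV f" "\<And>x. \<bar>f x\<bar> \<le> b"
  shows "\<bar>vol f\<bar> \<le> b * vol (\<lambda>_. 1)"
proof -
  have c: "continuous_on UNIV (\<lambda>_::'a. b)" "continuous_on UNIV (\<lambda>_::'a. - b)" by auto
  have "vol f \<le> vol (\<lambda>_. b)" "vol (\<lambda>_. - b) \<le> vol f"
    using vol_mono[OF assms(1) c(1)] vol_mono[OF c(2) assms(1)] assms(2)
    by (auto simp: abs_le_iff minus_le_iff)
  then show ?thesis using vol_cmult[of b "\<lambda>_. 1"] vol_cmult[of "- b" "\<lambda>_. 1"] by (simp add: abs_le_iff)
qed

lemma vol_eq_0_imp_zero:
  assumes "continuous_on UNIV f" "\<And>x. 0 \<le> f x" "vol f = 0"
  shows "f x = 0"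
  using vol_pos[OF assms(1,2), of x] assms(2)[of x] assms(3) by force

end

section \<open>Smooth families of functions\<close>

context compact_kaehler
begin

lemma smooth_fun_continuous_on:
  assumes "smooth_fun A f"
  shows "continuous_on UNIV f"
proof -
  have "continuous_on (\<Union>c\<in>A. fst c) f"
  proof (rule continuous_on_open_UN)
    fix c assume c: "c \<in> A"
    show "open (fst c)" using chart(1)[OF c] .
    have "C_infty_on (coord_image c) (f \<circ> param c)" using assms c by (simp add: smooth_fun_def)
    then have "continuous_on (coord_image c) (f \<circ> param c)" by (rule C_infty_on_imp_continuous_on)
    then have "continuous_on (fst c) (\<lambda>x. (f \<circ> param c) (snd c x))"
      by (rule continuous_on_compose2[OF _ chart(3)[OF c]]) (use chart(5)[OF c] in auto)
    moreover have "(f \<circ> param c) (snd c x) = f x" if "x \<in> fst c" for x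
      using chart(5)[OF c that] by simp
    ultimately show "continuous_on (fst c) f" by (simp cong: continuous_on_cong)
  qed
  moreover have "(\<Union>c\<in>A. fst c) = UNIV" using atlas by (simp add: complex_atlas_def)
  ultimately show ?thesis by simp
qed

lemma smooth_param_continuous_on:
  assumes "open P" "smooth_param A P G"
  shows "continuous_on (P \<times> UNIV) (\<lambda>(q, x). G q x)"
proof -
  have "continuous_on (\<Union>c\<in>A. P \<times> fst c) (\<lambda>(q, x). G q x)"
  proof (rule continuous_on_open_UN)
    fix c assume c: "c \<in> A"
    show "open (P \<times> fst c)" using chart(1)[OF c] assms(1) by (rule open_Times[rotated])
    have "C_infty_on (P \<times> coord_image c) (\<lambda>(q, z). G q (param c z))"
      using assms c by (simp add: smooth_param_def)
    then have "continuous_on (P \<times> coord_image c) (\<lambda>(q, z). G q (param c z))"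
      by (rule C_infty_on_imp_continuous_on)
    moreover have "continuous_on (P \<times> fst c) (\<lambda>p. (fst p, snd c (snd p)))"
      by (intro continuous_on_Pair continuous_on_fst continuous_on_id
          continuous_on_compose2[OF chart(3)[OF c]] continuous_on_snd) auto
    ultimately have "continuous_on (P \<times> fst c) (\<lambda>p. (\<lambda>(q, z). G q (param c z)) (fst p, snd c (snd p)))"
      by (rule continuous_on_compose2) (use chart(5)[OF c] in auto)
    then show "continuous_on (P \<times> fst c) (\<lambda>(q, x). G q x)"
      by (rule continuous_on_eq) (use chart(5)[OF c] in auto)
  qed
  moreover have "(\<Union>c\<in>A. P \<times> fst c) = P \<times> UNIV" using atlas by (auto simp: complex_atlas_def)
  ultimately show ?thesis by simp
qed

lemma open_P_coord: "open P \<Longrightarrow> c \<in> A \<Longrightarrow> open (P \<times> coord_image c)"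
  using chart(2) by (intro open_Times)

lemma smooth_param_cong:
  assumes "open P" "\<And>q. q \<in> P \<Longrightarrow> G q = H q" "smooth_param A P G"
  shows "smooth_param A P H"
  unfolding smooth_param_def
proof
  fix c assume c: "c \<in> A"
  show "C_infty_on (P \<times> coord_image c) (\<lambda>(q, z). H q (param c z))"
    by (rule C_infty_on_cong[OF open_P_coord[OF assms(1) c], where f = "\<lambda>(q, z). G q (param c z)"])
      (use assms c in \<open>auto simp: smooth_param_def\<close>)
qed

lemma smooth_param_compose_affine:
  fixes l :: "'q::real_normed_vector \<Rightarrow> 'p::real_normed_vector"
  assumes "open Q" "bounded_linear l" "\<And>q. q \<in> Q \<Longrightarrow> a + l q \<in> P" "smooth_param A P G"
  shows "smooth_param A Q (\<lambda>q. G (a + l q))"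
  unfolding smooth_param_def
proof
  fix c assume c: "c \<in> A"
  have "bounded_linear (\<lambda>(q, z::complex^'n). (l q, z))"
    using bounded_linear_Pair[OF bounded_linear_compose[OF assms(2) bounded_linear_fst] bounded_linear_snd]
    by (simp add: case_prod_unfold)
  then have "C_infty_on (Q \<times> coord_image c)
      (\<lambda>x. (\<lambda>(q, z). G q (param c z)) ((a, 0) + (\<lambda>(q, z). (l q, z)) x))"
    by (rule C_infty_on_compose_affine[OF open_P_coord[OF assms(1) c], where T = "P \<times> coord_image c"])
      (use assms c in \<open>auto simp: smooth_param_def\<close>)
  then show "C_infty_on (Q \<times> coord_image c) (\<lambda>(q, z). G (a + l q) (param c z))"
    by (simp add: case_prod_unfold)
qed

lemma smooth_param_slice:
  assumes "smooth_param A P G" "q \<in> P"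
  shows "smooth_fun A (G q)"
  unfolding smooth_fun_def
proof
  fix c assume c: "c \<in> A"
  have "bounded_linear (\<lambda>z::complex^'n. (0 :: 'b, z))"
    by (intro bounded_linear_Pair bounded_linear_zero bounded_linear_ident)
  then have "C_infty_on (coord_image c) (\<lambda>z. (\<lambda>(q, z). G q (param c z)) ((q, 0) + (0, z)))"
    by (rule C_infty_on_compose_affine[OF chart(2)[OF c], where T = "P \<times> coord_image c"])
      (use assms c in \<open>auto simp: smooth_param_def\<close>)
  then show "C_infty_on (coord_image c) (G q \<circ> param c)" by (simp add: comp_def)
qed

lemma smooth_param_fun:
  assumes "open P" "smooth_fun A f"
  shows "smooth_param A P (\<lambda>_. f)"
  unfolding smooth_param_def
proof
  fix c assume c: "c \<in> A"
  have "C_infty_on (P \<times> coord_image c) (\<lambda>x. (f \<circ> param c) (0 + snd x))"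
    by (rule C_infty_on_compose_affine[OF open_P_coord[OF assms(1) c] bounded_linear_snd,
          where T = "coord_image c"])
      (use assms c in \<open>auto simp: smooth_fun_def comp_def\<close>)
  then show "C_infty_on (P \<times> coord_image c) (\<lambda>(q, z). f (param c z))" by (simp add: case_prod_unfold)
qed

lemma smooth_param_scalar:
  assumes "open P" "C_infty_on P f"
  shows "smooth_param A P (\<lambda>q _. f q)"
  unfolding smooth_param_def
proof
  fix c assume c: "c \<in> A"
  have "C_infty_on (P \<times> coord_image c) (\<lambda>x. f (0 + fst x))"
    by (rule C_infty_on_compose_affine[OF open_P_coord[OF assms(1) c] bounded_linear_fst _ assms(2)]) auto
  then show "C_infty_on (P \<times> coord_image c) (\<lambda>(q, z). f q)" by (simp add: case_prod_unfold)
qed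

lemma smooth_param_add:
  assumes "open P" "smooth_param A P G" "smooth_param A P H"
  shows "smooth_param A P (\<lambda>q x. G q x + H q x)"
  using C_infty_on_add[OF open_P_coord[OF assms(1)]] assms(2,3)
  unfolding smooth_param_def split_beta by blast

lemma smooth_param_mult:
  assumes "open P" "smooth_param A P G" "smooth_param A P H"
  shows "smooth_param A P (\<lambda>q x. G q x * H q x)"
  using C_infty_on_mult[OF open_P_coord[OF assms(1)]] assms(2,3)
  unfolding smooth_param_def split_beta by blast

lemma smooth_param_const: "open P \<Longrightarrow> smooth_param A P (\<lambda>_ _. r)"
  by (intro smooth_param_scalar C_infty_on_const)

lemma smooth_param_minus:
  assumes "open P" "smooth_param A P G"
  shows "smooth_param A P (\<lambda>q x. - G q x)"
  using smooth_param_mult[OF assms(1) smooth_param_const[OF assms(1), of "- 1"] assms(2)] by simp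

lemma smooth_param_diff:
  assumes "open P" "smooth_param A P G" "smooth_param A P H"
  shows "smooth_param A P (\<lambda>q x. G q x - H q x)"
  using smooth_param_add[OF assms(1,2) smooth_param_minus[OF assms(1,3)]] by simp

lemma smooth_param_compose_real:
  assumes "open P" "open T" "\<And>q x. q \<in> P \<Longrightarrow> G q x \<in> T" "smooth_param A P G" "C_infty_on T g"
  shows "smooth_param A P (\<lambda>q x. g (G q x))"
  unfolding smooth_param_def
proof
  fix c assume c: "c \<in> A"
  have "C_infty_on (P \<times> coord_image c) (\<lambda>p. g ((\<lambda>(q, z). G q (param c z)) p))"
    by (rule C_infty_on_compose_real[OF open_P_coord[OF assms(1) c] assms(2) _ _ assms(5)])
      (use assms c in \<open>auto simp: smooth_param_def\<close>)
  then show "C_infty_on (P \<times> coord_image c) (\<lambda>(q, z). g (G q (param c z)))"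
    by (simp add: case_prod_unfold)
qed

lemma smooth_param_inverse:
  assumes "open P" "\<And>q x. q \<in> P \<Longrightarrow> G q x > 0" "smooth_param A P G"
  shows "smooth_param A P (\<lambda>q x. inverse (G q x))"
  by (rule smooth_param_compose_real[OF assms(1) _ _ assms(3) C_infty_on_inverse]) (use assms(2) in auto)

lemma smooth_param_partial_derivative:
  assumes "c \<in> A" "x \<in> fst c" "q \<in> P" "smooth_param A P G"
  shows "((\<lambda>q. G q x) has_derivative (\<lambda>v. frechet_derivative (\<lambda>(q, z). G q (param c z))
    (at (q, snd c x)) (v, 0))) (at q)"
proof -
  have "C_infty_on (P \<times> coord_image c) (\<lambda>(q, z). G q (param c z))"
    using assms by (simp add: smooth_param_def)
  then have "((\<lambda>(q, z). G q (param c z)) has_derivative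
      frechet_derivative (\<lambda>(q, z). G q (param c z)) (at (q, snd c x))) (at (q, snd c x))"
    by (rule C_infty_on_has_derivative) (use assms chart(5) in auto)
  moreover have "((\<lambda>q. (q, snd c x)) has_derivative (\<lambda>v. (v, 0))) (at q)"
    by (intro has_derivative_Pair has_derivative_ident has_derivative_const)
  ultimately show ?thesis
    using diff_chain_at[of "\<lambda>q. (q, snd c x)" "\<lambda>v. (v, 0)" q "\<lambda>(q, z). G q (param c z)"]
      chart(5)[OF assms(1,2)]
    by (simp add: comp_def)
qed

lemma smooth_param_has_derivative:
  assumes "smooth_param A P G" "q \<in> P"
  shows "((\<lambda>q. G q x) has_derivative frechet_derivative (\<lambda>q. G q x) (at q)) (at q)"
proof -
  obtain c where "c \<in> A" "x \<in> fst c" by (rule chart_exists)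
  from smooth_param_partial_derivative[OF this assms(2,1)]
  show ?thesis by (intro has_derivative_frechet) (auto simp: differentiable_def)
qed

lemma smooth_param_frechet_derivative:
  assumes "open P" "smooth_param A P G"
  shows "smooth_param A P (\<lambda>q x. frechet_derivative (\<lambda>q. G q x) (at q) v)"
  unfolding smooth_param_def
proof
  fix c assume c: "c \<in> A"
  show "C_infty_on (P \<times> coord_image c) (\<lambda>(q, z). frechet_derivative (\<lambda>q. G q (param c z)) (at q) v)"
  proof (rule C_infty_on_cong[OF open_P_coord[OF assms(1) c]])
    show "C_infty_on (P \<times> coord_image c)
        (\<lambda>p. frechet_derivative (\<lambda>(q, z). G q (param c z)) (at p) (v, 0))"
      using assms c by (intro C_infty_on_frechet_derivative) (simp add: smooth_param_def)
    fix p assume "p \<in> P \<times> coord_image c"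
    then obtain q z where p: "p = (q, z)" "q \<in> P" "z \<in> coord_image c" by auto
    have x: "param c z \<in> fst c" "snd c (param c z) = z" using chart(6)[OF c p(3)] by auto
    show "frechet_derivative (\<lambda>(q, z). G q (param c z)) (at p) (v, 0) =
        (case p of (q, z) \<Rightarrow> frechet_derivative (\<lambda>q. G q (param c z)) (at q) v)"
      using frechet_derivative_eq[OF smooth_param_partial_derivative[OF c x(1) p(2) assms(2)]]
      by (simp add: p(1) x(2))
  qed
qed

lemma velocity_has_derivative:
  assumes "smooth_param A I G" "t \<in> I"
  shows "((\<lambda>\<tau>. G \<tau> x) has_real_derivative velocity G t x) (at t)"
proof -
  have "(\<lambda>\<tau>. G \<tau> x) differentiable (at t)"
    using smooth_param_has_derivative[OF assms] by (auto simp: differentiable_def)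
  then show ?thesis
    unfolding velocity_def using DERIV_deriv_iff_real_differentiable by blast
qed

lemma smooth_param_velocity:
  assumes "open I" "smooth_param A I G"
  shows "smooth_param A I (velocity G)"
proof (rule smooth_param_cong[OF assms(1) _ smooth_param_frechet_derivative[OF assms, of 1]])
  fix t assume "t \<in> I"
  show "(\<lambda>x. frechet_derivative (\<lambda>q. G q x) (at t) 1) = velocity G t"
    using frechet_derivative_eq[OF velocity_has_derivative[OF assms(2) \<open>t \<in> I\<close>,
          unfolded has_field_derivative_def]]
    by (simp add: fun_eq_iff)
qed

lemma velocity_eqI: "((\<lambda>\<tau>. G \<tau> x) has_real_derivative D) (at t) \<Longrightarrow> velocity G t x = D"
  unfolding velocity_def by (rule DERIV_imp_deriv)

lemma smooth_param_slice_continuous_on: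
  "smooth_param A P G \<Longrightarrow> q \<in> P \<Longrightarrow> continuous_on UNIV (G q)"
  by (intro smooth_fun_continuous_on smooth_param_slice)

text \<open>Differentiation under the integral sign. On the compact manifold the difference quotients
  converge uniformly, and integration is bounded for the supremum norm.\<close>

lemma vol_has_derivative:
  assumes I: "open I" and G: "smooth_param A I G" and t: "t \<in> I"
  shows "((\<lambda>t. vol (G t)) has_real_derivative vol (velocity G t)) (at t)"
proof -
  have V: "smooth_param A I (velocity G)" by (rule smooth_param_velocity[OF I G])
  show ?thesis
    unfolding has_field_derivative_def has_derivative_at_alt
  proof (intro conjI allI impI)
    show "bounded_linear ((*) (vol (velocity G t)))" by (rule bounded_linear_mult_right)
    fix e :: real assume "e > 0"
    (* A uniform error e' in the integrand costs at most e' times the total volume. *)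
    define e' where "e' = e / vol (\<lambda>_. 1)"
    have e': "e' > 0" using \<open>e > 0\<close> vol_one_pos by (simp add: e'_def)
    obtain X where X: "t \<in> X" "open X"
      "\<forall>\<tau>\<in>X \<inter> I. \<forall>x\<in>UNIV. dist ((\<lambda>(q, x). velocity G q x) (\<tau>, x)) ((\<lambda>(q, x). velocity G q x) (t, x)) \<le> e'"
      by (rule continuous_on_prod_compactE[OF smooth_param_continuous_on[OF I V] compact_M t e']) blast
    then obtain d where d: "d > 0" "ball t d \<subseteq> X \<inter> I"
      using openE[OF open_Int[OF X(2) I], of t] X(1) t by blast
    (* The mean value inequality for the family minus its linear part at t. *)
    have diff: "\<bar>G y x - G t x - velocity G t x * (y - t)\<bar> \<le> e' * \<bar>y - t\<bar>" if y: "\<bar>y - t\<bar> < d" for y x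
    proof -
      have "norm ((G y x - velocity G t x * y) - (G t x - velocity G t x * t)) \<le> e' * norm (y - t)"
      proof (rule field_differentiable_bound[OF convex_ball[of t d], where f = "\<lambda>\<tau>. G \<tau> x - velocity G t x * \<tau>"])
        show "((\<lambda>\<tau>. G \<tau> x - velocity G t x * \<tau>) has_field_derivative velocity G \<tau> x - velocity G t x)
            (at \<tau> within ball t d)" if "\<tau> \<in> ball t d" for \<tau>
        proof -
          have "\<tau> \<in> I" using that d(2) by blast
          have "((\<lambda>\<tau>. G \<tau> x - velocity G t x * \<tau>) has_field_derivative
              velocity G \<tau> x - velocity G t x * 1) (at \<tau> within ball t d)"
            by (intro DERIV_diff DERIV_cmult DERIV_ident
                DERIV_subset[OF velocity_has_derivative[OF G \<open>\<tau> \<in> I\<close>]]) auto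
          then show ?thesis by simp
        qed
        show "norm (velocity G \<tau> x - velocity G t x) \<le> e'" if "\<tau> \<in> ball t d" for \<tau>
          using X(3) subsetD[OF d(2) that] by (simp add: dist_real_def)
      qed (use d y in \<open>auto simp: dist_real_def\<close>)
      then show ?thesis by (simp add: algebra_simps)
    qed
    show "\<exists>d>0. \<forall>y. norm (y - t) < d \<longrightarrow>
        norm (vol (G y) - vol (G t) - vol (velocity G t) * (y - t)) \<le> e * norm (y - t)"
    proof (intro exI[of _ d] conjI allI impI d)
      fix y assume y: "norm (y - t) < d"
      then have "y \<in> I" using d(2) by (auto simp: dist_real_def)
      note cont = smooth_param_slice_continuous_on[OF G \<open>y \<in> I\<close>] smooth_param_slice_continuous_on[OF G t]
        smooth_param_slice_continuous_on[OF V t]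
      have "vol (\<lambda>x. G y x - G t x - velocity G t x * (y - t))
          = vol (G y) - vol (G t) - vol (\<lambda>x. (y - t) * velocity G t x)"
        unfolding vol_diff[OF cont(1,2), symmetric] mult.commute[of _ "y - t"]
        by (rule vol_diff) (intro continuous_intros cont)+
      then have "vol (\<lambda>x. G y x - G t x - velocity G t x * (y - t))
          = vol (G y) - vol (G t) - vol (velocity G t) * (y - t)"
        by (simp add: vol_cmult mult.commute)
      moreover have "\<bar>vol (\<lambda>x. G y x - G t x - velocity G t x * (y - t))\<bar> \<le> e' * \<bar>y - t\<bar> * vol (\<lambda>_. 1)"
        by (intro vol_abs_le) (use diff y in \<open>auto intro!: continuous_intros cont\<close>)
      ultimately show "norm (vol (G y) - vol (G t) - vol (velocity G t) * (y - t)) \<le> e * norm (y - t)"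
        using vol_one_pos by (simp add: e'_def)
    qed
  qed
qed

lemma vol_C_infty_on:
  fixes I :: "real set"
  assumes I: "open I" and "smooth_param A I G"
  shows "C_infty_on I (\<lambda>t. vol (G t))"
proof -
  have "C_upto k I (\<lambda>t. vol (G t))" for k
    using assms(2)
  proof (induction k arbitrary: G)
    case 0
    have "isCont (\<lambda>t. vol (G t)) t" if "t \<in> I" for t
      using vol_has_derivative[OF I 0 that] by (rule DERIV_isCont)
    then show ?case by (simp add: continuous_at_imp_continuous_on)
  next
    case (Suc k)
    show ?case
    proof (rule C_upto_SucI[OF I, where f' = "\<lambda>t v. vol (velocity G t) * v"])
      show "((\<lambda>t. vol (G t)) has_derivative (*) (vol (velocity G t))) (at t)" if "t \<in> I" for t
        using vol_has_derivative[OF I Suc.prems that] by (simp add: has_field_derivative_def)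
      show "C_upto k I (\<lambda>t. vol (velocity G t) * v)" for v
        by (intro C_upto_mult[OF I Suc.IH[OF smooth_param_velocity[OF I Suc.prems]] C_upto_const[OF I]])
    qed
  qed
  then show ?thesis by (simp add: C_infty_on_def)
qed

end

section \<open>Curves, fields and families\<close>

context compact_kaehler
begin

lemma conformal_factors_iff:
  "F \<in> conformal_factors A \<omega> \<longleftrightarrow> smooth_fun A F \<and> (\<forall>x. F x > 0) \<and> vol F = vol (\<lambda>_. 1)"
  by (simp add: conformal_factors_def integral_omega_n_eq)

lemma conformal_tangent_iff: "G \<in> conformal_tangent A \<omega> \<longleftrightarrow> smooth_fun A G \<and> vol G = 0"
  by (simp add: conformal_tangent_def integral_omega_n_eq)

lemma smooth_curve_iff:
  "smooth_curve A \<omega> I F \<longleftrightarrow> open_interval I \<and> smooth_param A I F \<and>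
    (\<forall>t\<in>I. (\<forall>x. F t x > 0) \<and> vol (F t) = vol (\<lambda>_. 1))"
  unfolding smooth_curve_def conformal_factors_iff using smooth_param_slice by blast

lemma smooth_field_iff:
  "smooth_field A \<omega> I G \<longleftrightarrow> open_interval I \<and> smooth_param A I G \<and> (\<forall>t\<in>I. vol (G t) = 0)"
  unfolding smooth_field_def conformal_tangent_iff using smooth_param_slice by blast

lemma open_interval_open: "open_interval I \<Longrightarrow> open I"
  by (simp add: open_interval_def)

lemma smooth_curveD:
  assumes "smooth_curve A \<omega> I F"
  shows "open I" "smooth_param A I F" "t \<in> I \<Longrightarrow> F t x > 0" "t \<in> I \<Longrightarrow> vol (F t) = vol (\<lambda>_. 1)"
  using assms by (auto simp: smooth_curve_iff open_interval_open)

lemma smooth_fieldD: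
  assumes "smooth_field A \<omega> I G"
  shows "open I" "smooth_param A I G" "t \<in> I \<Longrightarrow> vol (G t) = 0"
  using assms by (auto simp: smooth_field_iff open_interval_open)

lemma vol_velocity_eq_0:
  assumes "open I" "smooth_param A I G" "\<And>t. t \<in> I \<Longrightarrow> vol (G t) = r" "t \<in> I"
  shows "vol (velocity G t) = 0"
proof -
  have "((\<lambda>t. vol (G t)) has_real_derivative 0) (at t)"
    by (rule has_field_derivative_transform_within_open[OF DERIV_const[of r] assms(1,4)])
      (simp add: assms(3))
  then show ?thesis
    using vol_has_derivative[OF assms(1,2,4)] DERIV_unique by blast
qed

lemma smooth_field_velocity:
  assumes "smooth_curve A \<omega> I F"
  shows "smooth_field A \<omega> I (velocity F)"
  using assms vol_velocity_eq_0[OF smooth_curveD(1,2)[OF assms] smooth_curveD(4)[OF assms]]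
    smooth_param_velocity[OF smooth_curveD(1,2)[OF assms]]
  by (auto simp: smooth_field_iff smooth_curve_iff)

lemma smooth_field_const:
  assumes "open_interval I" "G \<in> conformal_tangent A \<omega>"
  shows "smooth_field A \<omega> I (\<lambda>_. G)"
  using assms smooth_param_fun[OF open_interval_open] by (auto simp: smooth_field_iff conformal_tangent_iff)

lemma smooth_field_add:
  assumes "smooth_field A \<omega> I G" "smooth_field A \<omega> I H"
  shows "smooth_field A \<omega> I (\<lambda>t x. G t x + H t x)"
proof -
  have "vol (\<lambda>x. G t x + H t x) = 0" if "t \<in> I" for t
    using vol_add[OF smooth_param_slice_continuous_on[OF smooth_fieldD(2)[OF assms(1)] that]
        smooth_param_slice_continuous_on[OF smooth_fieldD(2)[OF assms(2)] that]]
      smooth_fieldD(3)[OF assms(1) that] smooth_fieldD(3)[OF assms(2) that]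
    by simp
  moreover have "smooth_param A I (\<lambda>t x. G t x + H t x)"
    by (intro smooth_param_add smooth_fieldD[OF assms(1)] smooth_fieldD[OF assms(2)])
  ultimately show ?thesis using assms(1) by (auto simp: smooth_field_iff)
qed

lemma smooth_field_diff:
  assumes "smooth_field A \<omega> I G" "smooth_field A \<omega> I H"
  shows "smooth_field A \<omega> I (\<lambda>t x. G t x - H t x)"
proof -
  have "vol (\<lambda>x. G t x - H t x) = 0" if "t \<in> I" for t
    using vol_diff[OF smooth_param_slice_continuous_on[OF smooth_fieldD(2)[OF assms(1)] that]
        smooth_param_slice_continuous_on[OF smooth_fieldD(2)[OF assms(2)] that]]
      smooth_fieldD(3)[OF assms(1) that] smooth_fieldD(3)[OF assms(2) that]
    by simp
  moreover have "smooth_param A I (\<lambda>t x. G t x - H t x)"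
    by (intro smooth_param_diff smooth_fieldD[OF assms(1)] smooth_fieldD[OF assms(2)])
  ultimately show ?thesis using assms(1) by (auto simp: smooth_field_iff)
qed

lemma smooth_field_slice: "smooth_field A \<omega> I G \<Longrightarrow> t \<in> I \<Longrightarrow> G t \<in> conformal_tangent A \<omega>"
  by (simp add: smooth_field_def)

text \<open>The derivative of a family in the parameter direction \<open>v\<close>. On \<open>\<real> \<times> \<real>\<close> it gives both partial
  derivatives as smooth families on the whole parameter domain.\<close>

definition dir_deriv :: "'p::real_normed_vector \<Rightarrow> ('p \<Rightarrow> 'a \<Rightarrow> real) \<Rightarrow> 'p \<Rightarrow> 'a \<Rightarrow> real" where
  "dir_deriv v G q x = frechet_derivative (\<lambda>q. G q x) (at q) v"

lemma smooth_param_dir_deriv: "open P \<Longrightarrow> smooth_param A P G \<Longrightarrow> smooth_param A P (dir_deriv v G)"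
  unfolding dir_deriv_def by (rule smooth_param_frechet_derivative)

lemma dir_deriv_has_derivative:
  fixes P :: "(real \<times> real) set"
  assumes "smooth_param A P G" "(t, s) \<in> P"
  shows "((\<lambda>\<tau>. G (\<tau>, s) x) has_real_derivative dir_deriv (1, 0) G (t, s) x) (at t)"
    and "((\<lambda>\<sigma>. G (t, \<sigma>) x) has_real_derivative dir_deriv (0, 1) G (t, s) x) (at s)"
proof -
  let ?D = "frechet_derivative (\<lambda>q. G q x) (at (t, s))"
  have D: "((\<lambda>q. G q x) has_derivative ?D) (at (t, s))"
    by (rule smooth_param_has_derivative[OF assms])
  have lin: "linear ?D" using D by (rule has_derivative_linear)
  have "((\<lambda>\<tau>. (\<tau>, s)) has_derivative (\<lambda>h. (h, 0))) (at t)"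
    by (intro has_derivative_Pair has_derivative_ident has_derivative_const)
  from diff_chain_at[OF this D] have "((\<lambda>\<tau>. G (\<tau>, s) x) has_derivative (\<lambda>h. ?D (h, 0))) (at t)"
    by (simp add: comp_def)
  moreover have "?D (h, 0) = dir_deriv (1, 0) G (t, s) x * h" for h
    using linear_scale[OF lin, of h "(1, 0)"] by (simp add: dir_deriv_def)
  ultimately show "((\<lambda>\<tau>. G (\<tau>, s) x) has_real_derivative dir_deriv (1, 0) G (t, s) x) (at t)"
    by (simp add: has_field_derivative_def)
  have "((\<lambda>\<sigma>. (t, \<sigma>)) has_derivative (\<lambda>h. (0, h))) (at s)"
    by (intro has_derivative_Pair has_derivative_ident has_derivative_const)
  from diff_chain_at[OF this D] have "((\<lambda>\<sigma>. G (t, \<sigma>) x) has_derivative (\<lambda>h. ?D (0, h))) (at s)"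
    by (simp add: comp_def)
  moreover have "?D (0, h) = dir_deriv (0, 1) G (t, s) x * h" for h
    using linear_scale[OF lin, of h "(0, 1)"] by (simp add: dir_deriv_def)
  ultimately show "((\<lambda>\<sigma>. G (t, \<sigma>) x) has_real_derivative dir_deriv (0, 1) G (t, s) x) (at s)"
    by (simp add: has_field_derivative_def)
qed

lemma dir_deriv_commute:
  fixes P :: "(real \<times> real) set"
  assumes P: "open P" "(t, s) \<in> P" and G: "smooth_param A P G"
  shows "dir_deriv (1, 0) (dir_deriv (0, 1) G) (t, s) x = dir_deriv (0, 1) (dir_deriv (1, 0) G) (t, s) x"
proof -
  have cont: "continuous_on P (\<lambda>(\<tau>, \<sigma>). H (\<tau>, \<sigma>) x)" if "smooth_param A P H" for H
  proof -
    have "continuous_on P (\<lambda>q. (\<lambda>(q, x). H q x) (q, x))"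
      by (rule continuous_on_compose2[OF smooth_param_continuous_on[OF P(1) that]])
        (auto intro!: continuous_intros)
    then show ?thesis by (simp add: case_prod_unfold)
  qed
  note sm = smooth_param_dir_deriv[OF P(1)]
  note G1 = sm[OF G, of "(1, 0)"] and G2 = sm[OF G, of "(0, 1)"]
  show ?thesis
    by (rule mixed_partials_eq[OF P, symmetric,
          where f = "\<lambda>\<tau> \<sigma>. G (\<tau>, \<sigma>) x"
            and fx = "\<lambda>\<tau> \<sigma>. dir_deriv (1, 0) G (\<tau>, \<sigma>) x"
            and fxy = "\<lambda>\<tau> \<sigma>. dir_deriv (0, 1) (dir_deriv (1, 0) G) (\<tau>, \<sigma>) x"
            and fy = "\<lambda>\<tau> \<sigma>. dir_deriv (0, 1) G (\<tau>, \<sigma>) x"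
            and fyx = "\<lambda>\<tau> \<sigma>. dir_deriv (1, 0) (dir_deriv (0, 1) G) (\<tau>, \<sigma>) x",
          OF dir_deriv_has_derivative(1)[OF G] dir_deriv_has_derivative(2)[OF G1]
            dir_deriv_has_derivative(2)[OF G] dir_deriv_has_derivative(1)[OF G2] cont[OF sm[OF G1]] cont[OF sm[OF G2]]])
qed

text \<open>The four curves and fields of a family that the torsion axiom refers to, and the symmetry of
  the mixed second derivatives, which is the torsion freeness of the flat derivative.\<close>

lemma smooth_family_slices:
  assumes "smooth_family A \<omega> I J F"
  shows "s \<in> J \<Longrightarrow> smooth_curve A \<omega> I (\<lambda>t. F t s)"
    and "t \<in> I \<Longrightarrow> smooth_curve A \<omega> J (F t)"
    and "s \<in> J \<Longrightarrow> smooth_field A \<omega> I (\<lambda>t. velocity (F t) s)"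
    and "t \<in> I \<Longrightarrow> smooth_field A \<omega> J (\<lambda>s. velocity (\<lambda>t. F t s) t)"
    and "t \<in> I \<Longrightarrow> s \<in> J \<Longrightarrow>
      velocity (\<lambda>t. velocity (F t) s) t x = velocity (\<lambda>s. velocity (\<lambda>t. F t s) t) s x"
proof -
  define G where "G q = (case q of (t, s) \<Rightarrow> F t s)" for q
  have IJ: "open_interval I" "open_interval J" and G: "smooth_param A (I \<times> J) G"
    and cf: "\<And>t s. t \<in> I \<Longrightarrow> s \<in> J \<Longrightarrow> F t s \<in> conformal_factors A \<omega>"
    using assms by (auto simp: smooth_family_def G_def[abs_def])
  note op = IJ[THEN open_interval_open]
  have opP: "open (I \<times> J)" using op by (rule open_Times)
  have sliceI: "smooth_param A I (\<lambda>t. H (t, s))" if "smooth_param A (I \<times> J) H" "s \<in> J" for H s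
  proof -
    have "bounded_linear (\<lambda>t. (t, 0) :: real \<times> real)"
      by (intro bounded_linear_Pair bounded_linear_ident bounded_linear_zero)
    from smooth_param_compose_affine[OF op(1) this _ that(1), of "(0, s)"] that(2) show ?thesis by simp
  qed
  have sliceJ: "smooth_param A J (\<lambda>s. H (t, s))" if "smooth_param A (I \<times> J) H" "t \<in> I" for H t
  proof -
    have "bounded_linear (\<lambda>s. (0, s) :: real \<times> real)"
      by (intro bounded_linear_Pair bounded_linear_ident bounded_linear_zero)
    from smooth_param_compose_affine[OF op(2) this _ that(1), of "(t, 0)"] that(2) show ?thesis by simp
  qed
  show c1: "smooth_curve A \<omega> I (\<lambda>t. F t s)" if "s \<in> J" for s
    using sliceI[OF G that] IJ cf that by (simp add: smooth_curve_def G_def)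
  show c2: "smooth_curve A \<omega> J (F t)" if "t \<in> I" for t
    using sliceJ[OF G that] IJ cf that by (simp add: smooth_curve_def G_def)
  have vs: "velocity (F t) s = dir_deriv (0, 1) G (t, s)" if "t \<in> I" "s \<in> J" for t s
    using dir_deriv_has_derivative(2)[OF G] that by (intro ext velocity_eqI) (simp add: G_def)
  have vt: "velocity (\<lambda>t. F t s) t = dir_deriv (1, 0) G (t, s)" if "t \<in> I" "s \<in> J" for t s
    using dir_deriv_has_derivative(1)[OF G] that by (intro ext velocity_eqI) (simp add: G_def)
  have sm: "smooth_param A (I \<times> J) (dir_deriv v G)" for v by (rule smooth_param_dir_deriv[OF opP G])
  show "smooth_field A \<omega> I (\<lambda>t. velocity (F t) s)" if s: "s \<in> J" for s
    unfolding smooth_field_def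
  proof (intro conjI ballI IJ)
    show "smooth_param A I (\<lambda>t. velocity (F t) s)"
      by (rule smooth_param_cong[OF op(1) _ sliceI[OF sm s]]) (simp add: vs s)
    show "velocity (F t) s \<in> conformal_tangent A \<omega>" if "t \<in> I" for t
      by (rule smooth_field_slice[OF smooth_field_velocity[OF c2[OF that]] s])
  qed
  show "smooth_field A \<omega> J (\<lambda>s. velocity (\<lambda>t. F t s) t)" if t: "t \<in> I" for t
    unfolding smooth_field_def
  proof (intro conjI ballI IJ)
    show "smooth_param A J (\<lambda>s. velocity (\<lambda>t. F t s) t)"
      by (rule smooth_param_cong[OF op(2) _ sliceJ[OF sm t]]) (simp add: vt t)
    show "velocity (\<lambda>t. F t s) t \<in> conformal_tangent A \<omega>" if "s \<in> J" for s
      by (rule smooth_field_slice[OF smooth_field_velocity[OF c1[OF that]] t])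
  qed
  assume ts: "t \<in> I" "s \<in> J"
  then have P: "(t, s) \<in> I \<times> J" by simp
  have "velocity (\<lambda>t. velocity (F t) s) t x = dir_deriv (1, 0) (dir_deriv (0, 1) G) (t, s) x"
    by (rule velocity_eqI, rule has_field_derivative_transform_within_open[OF dir_deriv_has_derivative(1)[OF sm P] op(1) ts(1)])
      (simp add: vs ts)
  also have "\<dots> = dir_deriv (0, 1) (dir_deriv (1, 0) G) (t, s) x"
    by (rule dir_deriv_commute[OF opP P G])
  also have "\<dots> = velocity (\<lambda>s. velocity (\<lambda>t. F t s) t) s x"
    by (rule sym, rule velocity_eqI,
        rule has_field_derivative_transform_within_open[OF dir_deriv_has_derivative(2)[OF sm P] op(2) ts(2)])
      (simp add: vt ts)
  finally show "velocity (\<lambda>t. velocity (F t) s) t x = velocity (\<lambda>s. velocity (\<lambda>t. F t s) t) s x" .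
qed

end

section \<open>The Levi-Civita connection of the weighted metric\<close>

locale weighted_kaehler = compact_kaehler +
  fixes chi :: "real \<Rightarrow> real"
  assumes chi_smooth: "C_infty_on {0<..} chi" and chi_pos: "r > 0 \<Longrightarrow> chi r > 0"
begin

text \<open>Half of the logarithmic derivative of the weight.\<close>

definition slope :: "real \<Rightarrow> real" where
  "slope r = deriv chi r / (2 * chi r)"

lemma slope_smooth: "C_infty_on {0<..} slope"
proof -
  have op: "open {0::real<..}" by simp
  have "C_infty_on {0<..} (\<lambda>r. inverse (chi r))"
    by (rule C_infty_on_compose_real[OF op op _ chi_smooth C_infty_on_inverse]) (auto simp: chi_pos)
  then have "C_infty_on {0<..} (\<lambda>r. deriv chi r * (inverse (chi r) * (1 / 2)))"
    by (intro C_infty_on_mult C_infty_on_deriv chi_smooth C_infty_on_const op)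
  then show ?thesis
    by (rule C_infty_on_cong[OF op, rotated]) (simp add: slope_def field_simps)
qed

lemma curve_smooth:
  assumes F: "smooth_curve A \<omega> I F"
  shows "smooth_param A I (\<lambda>t x. chi (F t x))" "smooth_param A I (\<lambda>t x. slope (F t x))"
    "smooth_param A I (\<lambda>t x. 1 / chi (F t x))"
proof -
  note D = smooth_curveD[OF F]
  show chi: "smooth_param A I (\<lambda>t x. chi (F t x))"
    by (rule smooth_param_compose_real[OF D(1) _ _ D(2) chi_smooth]) (auto simp: D(3))
  show "smooth_param A I (\<lambda>t x. slope (F t x))"
    by (rule smooth_param_compose_real[OF D(1) _ _ D(2) slope_smooth]) (auto simp: D(3))
  have "smooth_param A I (\<lambda>t x. inverse (chi (F t x)))"
    by (rule smooth_param_inverse[OF D(1) _ chi]) (auto simp: D(3) chi_pos)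
  then show "smooth_param A I (\<lambda>t x. 1 / chi (F t x))" by (simp add: inverse_eq_divide)
qed

lemma vol_inverse_chi_pos:
  assumes "smooth_curve A \<omega> I F" "t \<in> I"
  shows "vol (\<lambda>x. 1 / chi (F t x)) > 0"
proof (rule vol_pos)
  show "continuous_on UNIV (\<lambda>x. 1 / chi (F t x))"
    by (rule smooth_param_slice_continuous_on[OF curve_smooth(3)[OF assms(1)] assms(2)])
qed (use chi_pos smooth_curveD(3)[OF assms] in \<open>auto intro: less_imp_le\<close>)

text \<open>The difference between the Levi-Civita derivative on the space of all positive functions and
  the flat derivative \<open>velocity\<close>.\<close>

definition christoffel :: "(real \<Rightarrow> 'a \<Rightarrow> real) \<Rightarrow> (real \<Rightarrow> 'a \<Rightarrow> real) \<Rightarrow> real \<Rightarrow> 'a \<Rightarrow> real" where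
  "christoffel F G t x = slope (F t x) * velocity F t x * G t x"

text \<open>The Lagrange multiplier of the volume constraint: the component, along the normal direction
  \<open>1/\<chi>(F)\<close>, of the derivative before projection. The numerator is the integral of that derivative,
  to which \<open>velocity G\<close> contributes zero.\<close>

definition multiplier :: "(real \<Rightarrow> 'a \<Rightarrow> real) \<Rightarrow> (real \<Rightarrow> 'a \<Rightarrow> real) \<Rightarrow> real \<Rightarrow> real" where
  "multiplier F G t = vol (christoffel F G t) / vol (\<lambda>x. 1 / chi (F t x))"

definition covariant :: "(real \<Rightarrow> 'a \<Rightarrow> real) \<Rightarrow> (real \<Rightarrow> 'a \<Rightarrow> real) \<Rightarrow> real \<Rightarrow> 'a \<Rightarrow> real" where
  "covariant F G t x = velocity G t x + christoffel F G t x - 1 / chi (F t x) * multiplier F G t"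

lemma christoffel_smooth:
  assumes "smooth_curve A \<omega> I F" "smooth_field A \<omega> I G"
  shows "smooth_param A I (christoffel F G)"
  unfolding christoffel_def[abs_def]
  by (intro smooth_param_mult curve_smooth[OF assms(1)] smooth_param_velocity
      smooth_curveD[OF assms(1)] smooth_fieldD[OF assms(2)])

lemma smooth_field_covariant:
  assumes F: "smooth_curve A \<omega> I F" and G: "smooth_field A \<omega> I G"
  shows "smooth_field A \<omega> I (covariant F G)"
proof -
  note op = smooth_curveD(1)[OF F]
  note V = smooth_param_velocity[OF op smooth_fieldD(2)[OF G]]
  note C = christoffel_smooth[OF F G]
  note R = curve_smooth(3)[OF F]
  have "C_infty_on I (\<lambda>t. inverse (vol (\<lambda>x. 1 / chi (F t x))))"
    by (rule C_infty_on_compose_real[OF op _ _ vol_C_infty_on[OF op R] C_infty_on_inverse])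
      (auto simp: vol_inverse_chi_pos[OF F])
  then have "C_infty_on I (multiplier F G)"
    unfolding multiplier_def[abs_def] divide_inverse
    by (intro C_infty_on_mult vol_C_infty_on[OF op C] op) (simp add: divide_inverse)
  then have mR: "smooth_param A I (\<lambda>t x. 1 / chi (F t x) * multiplier F G t)"
    by (intro smooth_param_mult[OF op R] smooth_param_scalar op)
  then have "smooth_param A I (covariant F G)"
    unfolding covariant_def[abs_def]
    by (intro smooth_param_diff smooth_param_add op V C)
  moreover have "vol (covariant F G t) = 0" if t: "t \<in> I" for t
  proof -
    note cont = smooth_param_slice_continuous_on[OF _ t]
    have "vol (covariant F G t) = vol (\<lambda>x. velocity G t x + christoffel F G t x)
        - vol (\<lambda>x. 1 / chi (F t x) * multiplier F G t)"
      unfolding covariant_def[abs_def]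
      by (rule vol_diff[OF cont[OF smooth_param_add[OF op V C]] cont[OF mR]])
    also have "vol (\<lambda>x. velocity G t x + christoffel F G t x) = vol (christoffel F G t)"
      using vol_add[OF cont[OF V] cont[OF C]]
        vol_velocity_eq_0[OF op smooth_fieldD(2)[OF G] smooth_fieldD(3)[OF G] t]
      by simp
    also have "vol (\<lambda>x. 1 / chi (F t x) * multiplier F G t) = vol (christoffel F G t)"
      using vol_cmult[of "multiplier F G t" "\<lambda>x. 1 / chi (F t x)"] vol_inverse_chi_pos[OF F t]
      by (simp add: multiplier_def mult.commute)
    finally show ?thesis by simp
  qed
  ultimately show ?thesis using G by (simp add: smooth_field_iff)
qed

lemma covariant_add:
  assumes F: "smooth_curve A \<omega> I F" and G: "smooth_field A \<omega> I G" and H: "smooth_field A \<omega> I H"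
    and t: "t \<in> I"
  shows "covariant F (\<lambda>t x. G t x + H t x) t x = covariant F G t x + covariant F H t x"
proof -
  have v: "velocity (\<lambda>t x. G t x + H t x) t x = velocity G t x + velocity H t x"
    using velocity_has_derivative[OF smooth_fieldD(2)[OF G] t]
      velocity_has_derivative[OF smooth_fieldD(2)[OF H] t]
    by (intro velocity_eqI DERIV_add)
  have c: "christoffel F (\<lambda>t x. G t x + H t x) t = (\<lambda>x. christoffel F G t x + christoffel F H t x)"
    by (auto simp: christoffel_def algebra_simps)
  have "vol (\<lambda>x. christoffel F G t x + christoffel F H t x) = vol (christoffel F G t) + vol (christoffel F H t)"
    by (intro vol_add smooth_param_slice_continuous_on[OF christoffel_smooth[OF F] t] G H)
  then have "multiplier F (\<lambda>t x. G t x + H t x) t = multiplier F G t + multiplier F H t"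
    by (simp add: multiplier_def c add_divide_distrib)
  then show ?thesis by (simp add: covariant_def v c algebra_simps)
qed

lemma covariant_leibniz:
  assumes G: "smooth_field A \<omega> I G" and f: "C_infty_on I f" and t: "t \<in> I"
  shows "covariant F (\<lambda>t x. f t * G t x) t x = deriv f t * G t x + f t * covariant F G t x"
proof -
  have v: "velocity (\<lambda>t x. f t * G t x) t x = deriv f t * G t x + velocity G t x * f t"
    using velocity_has_derivative[OF smooth_fieldD(2)[OF G] t] C_infty_on_real_has_derivative[OF f t]
    by (intro velocity_eqI DERIV_mult)
  have c: "christoffel F (\<lambda>t x. f t * G t x) t = (\<lambda>x. f t * christoffel F G t x)"
    by (auto simp: christoffel_def)
  have "multiplier F (\<lambda>t x. f t * G t x) t = f t * multiplier F G t"
    by (simp add: multiplier_def c vol_cmult)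
  then show ?thesis by (simp add: covariant_def v c algebra_simps)
qed

lemma chi_covariant:
  assumes "smooth_curve A \<omega> I F" "t \<in> I"
  shows "chi (F t x) * covariant F G t x =
    chi (F t x) * velocity G t x + deriv chi (F t x) * velocity F t x * G t x / 2 - multiplier F G t"
  using chi_pos[OF smooth_curveD(3)[OF assms, of x]]
  by (simp add: covariant_def christoffel_def slope_def field_simps)

text \<open>Each covariant derivative carries half of the derivative of the weight. The Lagrange
  multipliers contribute constants, which tangent vectors integrate to zero.\<close>

lemma covariant_metric:
  assumes F: "smooth_curve A \<omega> I F" and G: "smooth_field A \<omega> I G" and H: "smooth_field A \<omega> I H"
    and t: "t \<in> I"
  shows "((\<lambda>t. weighted_metric A \<omega> chi (F t) (G t) (H t)) has_real_derivative
      weighted_metric A \<omega> chi (F t) (covariant F G t) (H t)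
    + weighted_metric A \<omega> chi (F t) (G t) (covariant F H t)) (at t)"
proof -
  note op = smooth_curveD(1)[OF F]
  note Fs = smooth_curveD(2)[OF F] and Gs = smooth_fieldD(2)[OF G] and Hs = smooth_fieldD(2)[OF H]
  note DG = smooth_fieldD(2)[OF smooth_field_covariant[OF F G]] and DH = smooth_fieldD(2)[OF smooth_field_covariant[OF F H]]
  note chiF = curve_smooth(1)[OF F]
  define W where "W t x = chi (F t x) * G t x * H t x" for t x
  have W: "smooth_param A I W"
    unfolding W_def[abs_def] by (intro smooth_param_mult op chiF Gs Hs)
  note cont = smooth_param_slice_continuous_on[OF _ t]
  have W': "velocity W t x = chi (F t x) * covariant F G t x * H t x + chi (F t x) * G t x * covariant F H t x
      + (multiplier F G t * H t x + multiplier F H t * G t x)" for x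
  proof -
    have "((\<lambda>t. chi (F t x)) has_real_derivative deriv chi (F t x) * velocity F t x) (at t)"
      by (rule DERIV_chain2[OF C_infty_on_real_has_derivative[OF chi_smooth]
            velocity_has_derivative[OF Fs t]])
        (simp add: smooth_curveD(3)[OF F t])
    then have "velocity W t x = (deriv chi (F t x) * velocity F t x * G t x
        + velocity G t x * chi (F t x)) * H t x + velocity H t x * (chi (F t x) * G t x)"
      unfolding W_def[abs_def]
      by (intro velocity_eqI DERIV_mult velocity_has_derivative[OF Gs t] velocity_has_derivative[OF Hs t])
    moreover have "chi (F t x) * covariant F G t x * H t x + G t x * (chi (F t x) * covariant F H t x)
        = (deriv chi (F t x) * velocity F t x * G t x + velocity G t x * chi (F t x)) * H t x
          + velocity H t x * (chi (F t x) * G t x)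
          - (multiplier F G t * H t x + multiplier F H t * G t x)"
      unfolding chi_covariant[OF F t] by (simp add: algebra_simps)
    ultimately show ?thesis by (simp add: mult_ac)
  qed
  have c1: "continuous_on UNIV (\<lambda>x. chi (F t x) * covariant F G t x * H t x)"
    and c2: "continuous_on UNIV (\<lambda>x. chi (F t x) * G t x * covariant F H t x)"
    by (intro continuous_intros cont chiF DG DH Gs Hs)+
  have c3: "continuous_on UNIV (\<lambda>x. multiplier F G t * H t x)"
    and c4: "continuous_on UNIV (\<lambda>x. multiplier F H t * G t x)"
    by (intro continuous_intros cont Gs Hs)+
  have "vol (velocity W t) = vol (\<lambda>x. chi (F t x) * covariant F G t x * H t x + chi (F t x) * G t x * covariant F H t x)
      + vol (\<lambda>x. multiplier F G t * H t x + multiplier F H t * G t x)"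
    unfolding W'[abs_def] by (intro vol_add continuous_on_add c1 c2 c3 c4)
  also have "vol (\<lambda>x. multiplier F G t * H t x + multiplier F H t * G t x) = 0"
    unfolding vol_add[OF c3 c4] vol_cmult
    by (simp add: smooth_fieldD(3)[OF G t] smooth_fieldD(3)[OF H t])
  finally have "vol (velocity W t) = weighted_metric A \<omega> chi (F t) (covariant F G t) (H t)
      + weighted_metric A \<omega> chi (F t) (G t) (covariant F H t)"
    unfolding weighted_metric_def vol_add[OF c1 c2] by simp
  then show ?thesis
    using vol_has_derivative[OF op W t] by (simp add: weighted_metric_def W_def[abs_def])
qed

lemma covariant_torsion_free:
  assumes fam: "smooth_family A \<omega> I J F" and t: "t \<in> I" and s: "s \<in> J"
  shows "covariant (\<lambda>t. F t s) (\<lambda>t. velocity (F t) s) t = covariant (F t) (\<lambda>s. velocity (\<lambda>t. F t s) t) s"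
proof -
  have c: "christoffel (\<lambda>t. F t s) (\<lambda>t. velocity (F t) s) t = christoffel (F t) (\<lambda>s. velocity (\<lambda>t. F t s) t) s"
    by (auto simp: christoffel_def)
  then have "multiplier (\<lambda>t. F t s) (\<lambda>t. velocity (F t) s) t = multiplier (F t) (\<lambda>s. velocity (\<lambda>t. F t s) t) s"
    by (simp add: multiplier_def)
  with c show ?thesis
    by (auto simp: covariant_def smooth_family_slices(5)[OF fam t s])
qed

text \<open>Outside its domain the connection has the value that \<open>is_levi_civita\<close> prescribes.\<close>

definition connection :: "'a covariant_derivative" where
  "connection I F G t =
    (if smooth_curve A \<omega> I F \<and> smooth_field A \<omega> I G \<and> t \<in> I then covariant F G t else undefined)"

lemma is_levi_civita_connection: "is_levi_civita A \<omega> chi connection"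
  unfolding is_levi_civita_def
proof (intro conjI allI impI ballI; (elim conjE)?)
  fix I F G assume F: "smooth_curve A \<omega> I F" and G: "smooth_field A \<omega> I G"
  note cG = smooth_field_covariant[OF F G]
  have eq: "connection I F G t = covariant F G t" if "t \<in> I" for t
    using that by (simp add: connection_def F G)
  have "smooth_param A I (connection I F G)"
    by (rule smooth_param_cong[OF smooth_fieldD(1)[OF cG] _ smooth_fieldD(2)[OF cG]]) (simp add: eq)
  then show "smooth_field A \<omega> I (connection I F G)"
    using cG by (simp add: smooth_field_def eq)
next
  fix I F G H t x
  assume "smooth_curve A \<omega> I F" and "smooth_field A \<omega> I G" and "smooth_field A \<omega> I H" and "t \<in> I"
  moreover have "smooth_field A \<omega> I (\<lambda>t x. G t x + H t x)"
    by (rule smooth_field_add[OF \<open>smooth_field A \<omega> I G\<close> \<open>smooth_field A \<omega> I H\<close>])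
  ultimately show "connection I F (\<lambda>t x. G t x + H t x) t x = connection I F G t x + connection I F H t x"
    using covariant_add by (simp add: connection_def)
next
  fix I F G t x and f :: "real \<Rightarrow> real"
  assume F: "smooth_curve A \<omega> I F" and G: "smooth_field A \<omega> I G" and f: "C_infty_on I f" and t: "t \<in> I"
  have "smooth_param A I (\<lambda>t x. f t * G t x)"
    by (intro smooth_param_mult smooth_param_scalar f smooth_fieldD[OF G])
  then have "smooth_field A \<omega> I (\<lambda>t x. f t * G t x)"
    using G by (simp add: smooth_field_iff vol_cmult)
  then show "connection I F (\<lambda>t x. f t * G t x) t x = deriv f t * G t x + f t * connection I F G t x"
    using covariant_leibniz[OF G f t] by (simp add: connection_def F G t)
next
  fix I F G H t
  assume "smooth_curve A \<omega> I F" and "smooth_field A \<omega> I G" and "smooth_field A \<omega> I H" and "t \<in> I"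
  then show "((\<lambda>t. weighted_metric A \<omega> chi (F t) (G t) (H t)) has_real_derivative
      weighted_metric A \<omega> chi (F t) (connection I F G t) (H t)
    + weighted_metric A \<omega> chi (F t) (G t) (connection I F H t)) (at t)"
    using covariant_metric by (simp add: connection_def)
next
  fix I J F t s assume fam: "smooth_family A \<omega> I J F" and t: "t \<in> I" and s: "s \<in> J"
  then show "connection I (\<lambda>t. F t s) (\<lambda>t. velocity (\<lambda>s. F t s) s) t
      = connection J (\<lambda>s. F t s) (\<lambda>s. velocity (\<lambda>t. F t s) t) s"
    using covariant_torsion_free[OF fam t s] smooth_family_slices(1-4)[OF fam]
    by (simp add: connection_def)
next
  fix I F G t assume "\<not> (smooth_curve A \<omega> I F \<and> smooth_field A \<omega> I G \<and> t \<in> I)"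
  then show "connection I F G t = undefined" by (auto simp: connection_def)
qed

end

section \<open>Uniqueness of the Levi-Civita connection\<close>

context weighted_kaehler
begin

abbreviation metric :: "('a \<Rightarrow> real) \<Rightarrow> ('a \<Rightarrow> real) \<Rightarrow> ('a \<Rightarrow> real) \<Rightarrow> real" where
  "metric \<equiv> weighted_metric A \<omega> chi"

lemma chi_compose_continuous_on:
  assumes "F \<in> conformal_factors A \<omega>"
  shows "continuous_on UNIV (\<lambda>x. chi (F x))"
proof (rule continuous_on_compose2[OF C_infty_on_imp_continuous_on[OF chi_smooth]])
  show "continuous_on UNIV F" "F ` UNIV \<subseteq> {0<..}"
    using assms smooth_fun_continuous_on by (auto simp: conformal_factors_iff)
qed

lemma tangent_continuous_on: "G \<in> conformal_tangent A \<omega> \<Longrightarrow> continuous_on UNIV G"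
  by (simp add: conformal_tangent_iff smooth_fun_continuous_on)

lemma metric_diff:
  assumes "F \<in> conformal_factors A \<omega>" "G \<in> conformal_tangent A \<omega>" "G' \<in> conformal_tangent A \<omega>"
    "H \<in> conformal_tangent A \<omega>"
  shows "metric F (\<lambda>x. G x - G' x) H = metric F G H - metric F G' H"
proof -
  have "vol (\<lambda>x. chi (F x) * G x * H x - chi (F x) * G' x * H x) =
      vol (\<lambda>x. chi (F x) * G x * H x) - vol (\<lambda>x. chi (F x) * G' x * H x)"
    by (intro vol_diff continuous_on_mult chi_compose_continuous_on tangent_continuous_on assms)
  then show ?thesis by (simp add: weighted_metric_def algebra_simps)
qed

lemma metric_commute: "metric F G H = metric F H G"
  by (simp add: weighted_metric_def mult_ac)

lemma metric_eq_0_imp_zero: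
  assumes F: "F \<in> conformal_factors A \<omega>" and G: "G \<in> conformal_tangent A \<omega>" and "metric F G G = 0"
  shows "G = (\<lambda>_. 0)"
proof
  fix x
  have pos: "chi (F x) > 0" for x using F chi_pos by (simp add: conformal_factors_iff)
  have "continuous_on UNIV (\<lambda>x. chi (F x) * G x * G x)"
    by (intro continuous_on_mult chi_compose_continuous_on tangent_continuous_on F G)
  moreover have "0 \<le> chi (F x) * G x * G x" for x
    using less_imp_le[OF pos] by (simp add: mult.assoc)
  ultimately have "chi (F x) * G x * G x = 0"
    by (rule vol_eq_0_imp_zero) (use assms(3) in \<open>simp add: weighted_metric_def\<close>)
  then show "G x = 0" using pos[of x] by simp
qed

text \<open>If \<open>\<bar>Y\<bar> \<le> b p\<close>, then \<open>Y/p\<close> and its means are bounded by \<open>b\<close>. So \<open>1 + s (Y/p - m)\<close> is positive for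
  \<open>\<bar>s\<bar> < e\<close> and every mean \<open>m\<close> as soon as \<open>2 e b < 1\<close>.\<close>

definition short :: "('a \<Rightarrow> real) \<Rightarrow> ('a \<Rightarrow> real) \<Rightarrow> real \<Rightarrow> bool" where
  "short p Y e \<longleftrightarrow> 0 < e \<and> (\<exists>b. (\<forall>x. \<bar>Y x\<bar> \<le> b * p x) \<and> 2 * e * b < 1)"

lemma short_exists:
  assumes p: "p \<in> conformal_factors A \<omega>" and Y: "Y \<in> conformal_tangent A \<omega>"
  shows "\<exists>e. short p Y e"
proof -
  have pos: "p x > 0" for x using p by (simp add: conformal_factors_iff)
  have "continuous_on UNIV (\<lambda>x. Y x / p x)"
    using p pos by (intro continuous_on_divide tangent_continuous_on Y smooth_fun_continuous_on)
      (auto simp: conformal_factors_iff less_imp_neq[symmetric])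
  then have "bounded (range (\<lambda>x. Y x / p x))"
    using compact_M by (intro compact_imp_bounded compact_continuous_image)
  then obtain b where b: "b > 0" "\<And>x. \<bar>Y x / p x\<bar> \<le> b"
    by (auto simp: bounded_pos)
  have "\<bar>Y x\<bar> \<le> b * p x" for x
    using b(2)[of x] pos[of x] by (simp add: abs_divide pos_divide_le_eq)
  then show ?thesis
    using b(1) unfolding short_def by (intro exI[of _ "1 / (4 * b)"]) (auto intro!: exI[of _ b])
qed

lemma short_mono:
  assumes "short p Y e" "0 < e'" "e' \<le> e"
  shows "short p Y e'"
proof -
  obtain b where b: "\<forall>x. \<bar>Y x\<bar> \<le> b * p x" "2 * e * b < 1" using assms by (auto simp: short_def)
  have "2 * e' * b < 1"
  proof (cases "b \<ge> 0")
    case True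
    then have "2 * e' * b \<le> 2 * e * b" using assms(3) by (intro mult_right_mono) auto
    then show ?thesis using b(2) by simp
  next
    case False
    then have "e' * b \<le> 0" using assms(2) by (simp add: mult_nonneg_nonpos)
    then show ?thesis by linarith
  qed
  then show ?thesis using assms(2) b(1) by (auto simp: short_def)
qed

definition segment_curve :: "('a \<Rightarrow> real) \<Rightarrow> ('a \<Rightarrow> real) \<Rightarrow> real \<Rightarrow> 'a \<Rightarrow> real" where
  "segment_curve p Y s x = p x + s * Y x"

text \<open>A family to which torsion freeness is applied. It is \<open>F t\<close> times \<open>1 + s (Z - c
  t)\<close> with \<open>Z = Y / F t\<^sub>0\<close>. The mean \<open>c t\<close> of \<open>Z\<close> is
  subtracted to preserve the total mass for every \<open>t\<close>, and it vanishes at \<open>t\<^sub>0\<close>;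
  writing the family as a multiple of \<open>F t\<close> makes it positive although \<open>F\<close> may
  approach zero at the ends of \<open>I\<close>.\<close>

lemma family_through_curve:
  assumes F: "smooth_curve A \<omega> I F" and t0: "t0 \<in> I" and Y: "Y \<in> conformal_tangent A \<omega>"
    and e: "short (F t0) Y e"
  obtains Fam where "smooth_family A \<omega> I {- e <..< e} Fam" "(\<lambda>t. Fam t 0) = F"
    "Fam t0 = segment_curve (F t0) Y" "velocity (Fam t0) 0 = Y"
proof -
  define J where "J = {- e <..< e}"
  define V where "V = vol (\<lambda>_. 1)"
  define Z where "Z x = Y x / F t0 x" for x
  (* The mean of Z for the probability density F t / V. *)
  define c where "c t = vol (\<lambda>x. F t x * Z x) * (1 / V)" for t
  define Fam where "Fam t s x = F t x * (1 + s * (Z x - c t))" for t s x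
  obtain b where b: "\<And>x. \<bar>Y x\<bar> \<le> b * F t0 x" "2 * e * b < 1" and e0: "0 < e"
    using e by (auto simp: short_def)
  note FD = smooth_curveD[OF F]
  have V: "V > 0" using vol_one_pos by (simp add: V_def)
  have J: "open_interval J" "open J"
    using e0 by (auto simp: open_interval_def J_def is_interval_oo)
  have opP: "open (I \<times> J)" using FD(1) J(2) by (rule open_Times)
  have Z: "smooth_fun A Z"
  proof -
    have "smooth_param A I (\<lambda>t x. Y x * inverse (F t x))"
      by (intro smooth_param_mult smooth_param_fun smooth_param_inverse FD)
        (use Y in \<open>auto simp: conformal_tangent_iff\<close>)
    then have "smooth_fun A (\<lambda>x. Y x * inverse (F t0 x))" by (rule smooth_param_slice[OF _ t0])
    then show ?thesis by (simp add: Z_def[abs_def] divide_inverse)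
  qed
  have FZ: "smooth_param A I (\<lambda>t x. F t x * Z x)"
    by (intro smooth_param_mult smooth_param_fun Z FD(1,2))
  have c: "C_infty_on I c"
    unfolding c_def[abs_def] by (intro C_infty_on_mult vol_C_infty_on FD(1) FZ C_infty_on_const)
  have Zb: "\<bar>Z x\<bar> \<le> b" for x
    using b(1)[of x] FD(3)[OF t0, of x] by (simp add: Z_def abs_divide pos_divide_le_eq)
  have cb: "\<bar>c t\<bar> \<le> b" if t: "t \<in> I" for t
  proof -
    note cF = smooth_param_slice_continuous_on[OF FD(2) t] and cFZ = smooth_param_slice_continuous_on[OF FZ t]
    have FZb: "\<bar>F t x * Z x\<bar> \<le> b * F t x" for x
      using mult_left_mono[OF Zb less_imp_le[OF FD(3)[OF t]], of x x] FD(3)[OF t, of x]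
      by (simp add: abs_mult mult.commute)
    have "vol (\<lambda>x. F t x * Z x) \<le> vol (\<lambda>x. b * F t x)"
      by (rule vol_mono[OF cFZ]) (use FZb in \<open>auto intro!: continuous_intros cF simp: abs_le_iff\<close>)
    moreover have "vol (\<lambda>x. - b * F t x) \<le> vol (\<lambda>x. F t x * Z x)"
      by (rule vol_mono[OF _ cFZ])
        (use FZb in \<open>auto intro!: continuous_intros cF simp: abs_le_iff minus_le_iff\<close>)
    ultimately have "\<bar>vol (\<lambda>x. F t x * Z x)\<bar> \<le> b * V"
      unfolding vol_cmult FD(4)[OF t] V_def by (simp add: abs_le_iff)
    then show ?thesis using V by (simp add: c_def abs_divide pos_divide_le_eq)
  qed
  have smooth: "smooth_param A (I \<times> J) (\<lambda>(t, s). Fam t s)"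
  proof -
    have "smooth_param A (I \<times> J) (\<lambda>q. F (0 + fst q))"
      by (rule smooth_param_compose_affine[OF opP bounded_linear_fst _ FD(2)]) auto
    moreover have "C_infty_on (I \<times> J) (\<lambda>q. c (0 + fst q))"
      by (rule C_infty_on_compose_affine[OF opP bounded_linear_fst _ c]) auto
    moreover have "C_infty_on (I \<times> J) (snd :: real \<times> real \<Rightarrow> real)"
      by (simp add: C_infty_on_def C_upto_bounded_linear[OF opP bounded_linear_snd])
    ultimately have "smooth_param A (I \<times> J) (\<lambda>q x. F (0 + fst q) x * (1 + snd q * (Z x - c (0 + fst q))))"
      by (intro smooth_param_mult smooth_param_add smooth_param_diff smooth_param_const
          smooth_param_scalar smooth_param_fun opP Z)
    then show ?thesis by (simp add: Fam_def[abs_def] case_prod_unfold)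
  qed
  have factors: "Fam t s \<in> conformal_factors A \<omega>" if t: "t \<in> I" and s: "s \<in> J" for t s
  proof -
    have "smooth_fun A (Fam t s)"
      using smooth_param_slice[OF smooth, of "(t, s)"] t s by simp
    moreover have "Fam t s x > 0" for x
    proof -
      have "\<bar>s * (Z x - c t)\<bar> = \<bar>s\<bar> * \<bar>Z x - c t\<bar>" by (simp add: abs_mult)
      also have "\<dots> \<le> e * (2 * b)"
        using s Zb[of x] cb[OF t] e0 by (intro mult_mono) (auto simp: J_def)
      finally have "1 + s * (Z x - c t) > 0" using b(2) by simp
      then show ?thesis using FD(3)[OF t] by (simp add: Fam_def)
    qed
    moreover have "vol (Fam t s) = vol (\<lambda>_. 1)"
    proof -
      note cF = smooth_param_slice_continuous_on[OF FD(2) t] and cFZ = smooth_param_slice_continuous_on[OF FZ t]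
      have "vol (Fam t s) = vol (\<lambda>x. F t x + s * (F t x * Z x - c t * F t x))"
        by (simp add: Fam_def[abs_def] algebra_simps)
      also have "\<dots> = vol (F t) + s * vol (\<lambda>x. F t x * Z x - c t * F t x)"
        unfolding vol_cmult[symmetric] by (rule vol_add) (intro continuous_intros cF cFZ)+
      also have "vol (\<lambda>x. F t x * Z x - c t * F t x) = vol (\<lambda>x. F t x * Z x) - vol (\<lambda>x. c t * F t x)"
        by (rule vol_diff) (intro continuous_intros cF cFZ)+
      also have "\<dots> = 0" unfolding vol_cmult[of "c t"] using V FD(4)[OF t] by (simp add: c_def V_def)
      finally show ?thesis using FD(4)[OF t] by simp
    qed
    ultimately show ?thesis by (simp add: conformal_factors_iff)
  qed
  have p: "F t0 x \<noteq> 0" for x using FD(3)[OF t0, of x] by simp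
  have "(\<lambda>x. F t0 x * Z x) = Y" using p by (simp add: Z_def fun_eq_iff)
  then have "c t0 = 0" using Y by (simp add: c_def conformal_tangent_iff)
  then have Fam0: "Fam t0 = segment_curve (F t0) Y"
    using p by (simp add: Fam_def Z_def segment_curve_def fun_eq_iff algebra_simps)
  show thesis
  proof (rule that[of Fam])
    show "smooth_family A \<omega> I {- e <..< e} Fam"
      using F J(1) smooth factors by (simp add: smooth_family_def smooth_curve_def J_def)
    show "(\<lambda>t. Fam t 0) = F" by (simp add: Fam_def fun_eq_iff)
    show "Fam t0 = segment_curve (F t0) Y" by (rule Fam0)
    show "velocity (Fam t0) 0 = Y"
      unfolding Fam0 segment_curve_def[abs_def]
      by (rule ext, rule velocity_eqI) (auto intro!: derivative_eq_intros)
  qed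
qed

text \<open>A segment is the transversal curve of the family through a constant curve.\<close>

lemma smooth_curve_segment:
  assumes "p \<in> conformal_factors A \<omega>" "Y \<in> conformal_tangent A \<omega>" "short p Y e"
  shows "smooth_curve A \<omega> {- e <..< e} (segment_curve p Y)"
proof -
  have p: "smooth_curve A \<omega> UNIV (\<lambda>_. p)"
    using assms(1) by (auto simp: smooth_curve_def open_interval_def conformal_factors_iff intro!: smooth_param_fun)
  obtain Fam where fam: "smooth_family A \<omega> UNIV {- e <..< e} Fam" and seg: "Fam 0 = segment_curve p Y"
    by (rule family_through_curve[OF p UNIV_I assms(2,3), of 0])
  from smooth_family_slices(2)[OF fam UNIV_I, of 0] show ?thesis by (simp add: seg)
qed

lemma velocity_segment: "velocity (segment_curve p Y) s = Y"
  unfolding segment_curve_def[abs_def]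
  by (rule ext, rule velocity_eqI) (auto intro!: derivative_eq_intros)

lemma is_levi_civitaD:
  assumes "is_levi_civita A \<omega> chi D"
  shows "smooth_curve A \<omega> I F \<Longrightarrow> smooth_field A \<omega> I G \<Longrightarrow> smooth_field A \<omega> I (D I F G)"
    and "smooth_curve A \<omega> I F \<Longrightarrow> smooth_field A \<omega> I G \<Longrightarrow> smooth_field A \<omega> I H \<Longrightarrow> t \<in> I \<Longrightarrow>
      ((\<lambda>t. metric (F t) (G t) (H t)) has_real_derivative
        metric (F t) (D I F G t) (H t) + metric (F t) (G t) (D I F H t)) (at t)"
    and "smooth_family A \<omega> I J Fam \<Longrightarrow> t \<in> I \<Longrightarrow> s \<in> J \<Longrightarrow>
      D I (\<lambda>t. Fam t s) (\<lambda>t. velocity (Fam t) s) t = D J (Fam t) (\<lambda>s. velocity (\<lambda>t. Fam t s) t) s"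
    and "\<not> (smooth_curve A \<omega> I F \<and> smooth_field A \<omega> I G \<and> t \<in> I) \<Longrightarrow> D I F G t = undefined"
proof -
  note L = assms[unfolded is_levi_civita_def]
  note L2 = L[THEN conjunct2, THEN conjunct2, THEN conjunct2]
  show "smooth_field A \<omega> I (D I F G)" if "smooth_curve A \<omega> I F" "smooth_field A \<omega> I G"
    using L[THEN conjunct1, rule_format, OF conjI[OF that]] .
  show "((\<lambda>t. metric (F t) (G t) (H t)) has_real_derivative
        metric (F t) (D I F G t) (H t) + metric (F t) (G t) (D I F H t)) (at t)"
    if "smooth_curve A \<omega> I F" "smooth_field A \<omega> I G" "smooth_field A \<omega> I H" "t \<in> I"
    using L2[THEN conjunct1, rule_format, OF conjI[OF that(1) conjI[OF that(2,3)]] that(4)] .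
  show "D I (\<lambda>t. Fam t s) (\<lambda>t. velocity (Fam t) s) t = D J (Fam t) (\<lambda>s. velocity (\<lambda>t. Fam t s) t) s"
    if "smooth_family A \<omega> I J Fam" "t \<in> I" "s \<in> J"
    using L2[THEN conjunct2, THEN conjunct1, rule_format, OF that] .
  show "D I F G t = undefined" if "\<not> (smooth_curve A \<omega> I F \<and> smooth_field A \<omega> I G \<and> t \<in> I)"
    using L2[THEN conjunct2, THEN conjunct2, rule_format, OF that] .
qed

lemma curve_slice: "smooth_curve A \<omega> I F \<Longrightarrow> t \<in> I \<Longrightarrow> F t \<in> conformal_factors A \<omega>"
  by (simp add: smooth_curve_def)

context
  fixes D D' :: "'a covariant_derivative"
  assumes D: "is_levi_civita A \<omega> chi D" and D': "is_levi_civita A \<omega> chi D'"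
begin

definition gap :: "'a covariant_derivative" where
  "gap I F G t x = D I F G t x - D' I F G t x"

lemma smooth_field_gap:
  "smooth_curve A \<omega> I F \<Longrightarrow> smooth_field A \<omega> I G \<Longrightarrow> smooth_field A \<omega> I (gap I F G)"
  unfolding gap_def[abs_def] by (intro smooth_field_diff is_levi_civitaD(1)[OF D] is_levi_civitaD(1)[OF D'])

lemma gap_skew:
  assumes F: "smooth_curve A \<omega> I F" and G: "smooth_field A \<omega> I G" and H: "smooth_field A \<omega> I H"
    and t: "t \<in> I"
  shows "metric (F t) (gap I F G t) (H t) = - metric (F t) (G t) (gap I F H t)"
proof -
  note DG = is_levi_civitaD(1)[OF D F G, THEN smooth_field_slice, OF t]
  note DG' = is_levi_civitaD(1)[OF D' F G, THEN smooth_field_slice, OF t]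
  note DH = is_levi_civitaD(1)[OF D F H, THEN smooth_field_slice, OF t]
  note DH' = is_levi_civitaD(1)[OF D' F H, THEN smooth_field_slice, OF t]
  note Ft = curve_slice[OF F t] and Gt = smooth_field_slice[OF G t] and Ht = smooth_field_slice[OF H t]
  have "metric (F t) (D I F G t) (H t) + metric (F t) (G t) (D I F H t) =
      metric (F t) (D' I F G t) (H t) + metric (F t) (G t) (D' I F H t)"
    using is_levi_civitaD(2)[OF D F G H t] is_levi_civitaD(2)[OF D' F G H t] by (rule DERIV_unique)
  moreover have "metric (F t) (gap I F G t) (H t) = metric (F t) (D I F G t) (H t) - metric (F t) (D' I F G t) (H t)"
    unfolding gap_def[abs_def] by (rule metric_diff[OF Ft DG DG' Ht])
  moreover have "metric (F t) (gap I F H t) (G t) = metric (F t) (D I F H t) (G t) - metric (F t) (D' I F H t) (G t)"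
    unfolding gap_def[abs_def] by (rule metric_diff[OF Ft DH DH' Gt])
  ultimately show ?thesis
    using metric_commute[of "F t" "G t"] by simp
qed

text \<open>By skewness, the pairing of the gap with a constant field involves only the value of \<open>G\<close> at
  \<open>t\<close>. The constant field is taken to be the difference to be shown zero.\<close>

lemma gap_pointwise:
  assumes F: "smooth_curve A \<omega> I F" and G: "smooth_field A \<omega> I G" and G': "smooth_field A \<omega> I G'"
    and t: "t \<in> I" and eq: "G t = G' t"
  shows "gap I F G t = gap I F G' t"
proof -
  define U where "U x = gap I F G t x - gap I F G' t x" for x
  note S = smooth_field_slice[OF smooth_field_gap[OF F G] t] and S' = smooth_field_slice[OF smooth_field_gap[OF F G'] t]
  have U: "U \<in> conformal_tangent A \<omega>"
    using smooth_field_slice[OF smooth_field_diff[OF smooth_field_gap[OF F G] smooth_field_gap[OF F G']] t]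
    by (simp add: U_def[abs_def])
  have "open_interval I" using F by (simp add: smooth_curve_def)
  note H = smooth_field_const[OF this U]
  have "metric (F t) U U = metric (F t) (gap I F G t) U - metric (F t) (gap I F G' t) U"
    using metric_diff[OF curve_slice[OF F t] S S' U] by (simp add: U_def[abs_def])
  also have "\<dots> = 0"
    using gap_skew[OF F G H t] gap_skew[OF F G' H t] by (simp add: eq)
  finally have "U = (\<lambda>_. 0)" by (rule metric_eq_0_imp_zero[OF curve_slice[OF F t] U])
  then show ?thesis by (simp add: U_def fun_eq_iff)
qed

text \<open>Torsion freeness for the family through \<open>F\<close> with transversal segment. On the right side the
  curve \<open>F\<close> occurs only through its point and its velocity at \<open>t\<close>, and the parameter interval \<open>I\<close> has
  disappeared.\<close>

lemma gap_swap:
  assumes F: "smooth_curve A \<omega> I F" and G: "smooth_field A \<omega> I G" and t: "t \<in> I"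
    and e: "short (F t) (G t) e"
  shows "gap I F G t = gap {- e <..< e} (segment_curve (F t) (G t)) (\<lambda>_. velocity F t) 0"
proof -
  have e0: "0 \<in> {- e <..< e}" and oi: "open_interval {- e <..< e}"
    using e by (auto simp: short_def open_interval_def is_interval_oo)
  obtain Fam where fam: "smooth_family A \<omega> I {- e <..< e} Fam" and F0: "(\<lambda>t. Fam t 0) = F"
    and seg: "Fam t = segment_curve (F t) (G t)" and vel: "velocity (Fam t) 0 = G t"
    by (rule family_through_curve[OF F t smooth_field_slice[OF G t] e])
  note slices = smooth_family_slices[OF fam]
  have "gap I F G t = gap I F (\<lambda>t. velocity (Fam t) 0) t"
    by (rule gap_pointwise[OF F G slices(3)[OF e0] t]) (simp add: vel)
  also have "\<dots> = gap {- e <..< e} (Fam t) (\<lambda>s. velocity (\<lambda>t. Fam t s) t) 0"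
    using is_levi_civitaD(3)[OF D fam t e0] is_levi_civitaD(3)[OF D' fam t e0]
    by (simp add: gap_def[abs_def] F0)
  also have "\<dots> = gap {- e <..< e} (Fam t) (\<lambda>_. velocity F t) 0"
    by (rule gap_pointwise[OF slices(2)[OF t] slices(4)[OF t] _ e0])
      (auto simp: F0 intro!: smooth_field_const[OF oi] smooth_field_slice[OF smooth_field_velocity[OF F] t])
  finally show ?thesis by (simp add: seg)
qed

text \<open>On segments through a fixed point \<open>p\<close>, the gap is a function \<open>\<beta>\<close> of the velocity and the field,
  symmetric by \<open>gap_swap\<close>. Then \<open>\<langle>\<beta> U W, W'\<rangle>\<close> is symmetric in \<open>U, W\<close> and skew in \<open>W, W'\<close>. Six
  alternating exchanges restore the order and change the sign, so it vanishes.\<close>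

lemma gap_eq_0:
  assumes F: "smooth_curve A \<omega> I F" and G: "smooth_field A \<omega> I G" and t: "t \<in> I"
  shows "gap I F G t = (\<lambda>_. 0)"
proof -
  define p where "p = F t"
  define X where "X = velocity F t"
  define Y where "Y = G t"
  define Z where "Z = gap I F G t"
  let ?T = "conformal_tangent A \<omega>"
  have p: "p \<in> conformal_factors A \<omega>" using curve_slice[OF F t] by (simp add: p_def)
  have X: "X \<in> ?T" using smooth_field_slice[OF smooth_field_velocity[OF F] t] by (simp add: X_def)
  have Y: "Y \<in> ?T" using smooth_field_slice[OF G t] by (simp add: Y_def)
  have Z: "Z \<in> ?T" using smooth_field_slice[OF smooth_field_gap[OF F G] t] by (simp add: Z_def)
  obtain eX eY eZ where "short p X eX" "short p Y eY" "short p Z eZ"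
    using short_exists[OF p X] short_exists[OF p Y] short_exists[OF p Z] by blast
  (* One interval for all three directions, including that of the gap itself. *)
  then obtain e where e: "short p X e" "short p Y e" "short p Z e" and e_pos: "0 < e"
    using short_mono[of p X eX "min eX (min eY eZ)"] short_mono[of p Y eY "min eX (min eY eZ)"]
      short_mono[of p Z eZ "min eX (min eY eZ)"]
    by (auto simp: short_def)
  define J where "J = {- e <..< e}"
  have J: "0 \<in> J" "open_interval J"
    using e_pos by (auto simp: J_def open_interval_def is_interval_oo)
  define N where "N = {U \<in> ?T. short p U e}"
  have XYZ: "X \<in> N" "Y \<in> N" "Z \<in> N" using X Y Z e by (auto simp: N_def)
  define \<beta> where "\<beta> U W = gap J (segment_curve p U) (\<lambda>_. W) 0" for U W
  have seg: "smooth_curve A \<omega> J (segment_curve p U)" if "U \<in> N" for U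
    using smooth_curve_segment[OF p] that by (auto simp: N_def J_def)
  have const: "smooth_field A \<omega> J (\<lambda>_. W)" if "W \<in> N" for W
    using smooth_field_const[OF J(2)] that by (auto simp: N_def)
  have seg0: "segment_curve p U 0 = p" for U by (simp add: segment_curve_def fun_eq_iff)
  have sym: "\<beta> U W = \<beta> W U" if "U \<in> N" "W \<in> N" for U W
    using gap_swap[OF seg[OF that(1)] const[OF that(2)] J(1), of e] that
    by (simp add: \<beta>_def seg0 velocity_segment N_def J_def)
  have skew: "metric p (\<beta> U W) W' = - metric p (\<beta> U W') W" if "U \<in> N" "W \<in> N" "W' \<in> N" for U W W'
    using gap_skew[OF seg[OF that(1)] const[OF that(2)] const[OF that(3)] J(1)]
    by (simp add: \<beta>_def seg0 metric_commute[of p W])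
  have "Z = \<beta> Y X"
    using gap_swap[OF F G t, of e] e(2) by (simp add: \<beta>_def Z_def p_def Y_def X_def J_def)
  moreover have "metric p (\<beta> Y X) Z = - metric p (\<beta> Y X) Z"
  proof -
    have "metric p (\<beta> Y X) Z = - metric p (\<beta> Y Z) X" by (rule skew) (rule XYZ)+
    also have "\<dots> = - metric p (\<beta> Z Y) X" using sym XYZ by simp
    also have "\<dots> = metric p (\<beta> Z X) Y" using skew[of Z Y X] XYZ by simp
    also have "\<dots> = metric p (\<beta> X Z) Y" using sym XYZ by simp
    also have "\<dots> = - metric p (\<beta> X Y) Z" by (rule skew) (rule XYZ)+
    also have "\<dots> = - metric p (\<beta> Y X) Z" using sym XYZ by simp
    finally show ?thesis .
  qed
  ultimately have "metric p Z Z = 0" by simp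
  then show ?thesis using metric_eq_0_imp_zero[OF p Z] by (simp add: Z_def)
qed

lemma levi_civita_unique: "D = D'"
proof (intro ext)
  fix I F G t x
  show "D I F G t x = D' I F G t x"
  proof (cases "smooth_curve A \<omega> I F \<and> smooth_field A \<omega> I G \<and> t \<in> I")
    case True
    then have "gap I F G t = (\<lambda>_. 0)" by (intro gap_eq_0) auto
    then show ?thesis by (simp add: gap_def fun_eq_iff)
  next
    case False
    show ?thesis using is_levi_civitaD(4)[OF D False] is_levi_civitaD(4)[OF D' False] by simp
  qed
qed

end

lemma levi_civita_eq_connection: "levi_civita A \<omega> chi = connection"
  unfolding levi_civita_def
  by (rule the_equality, rule is_levi_civita_connection) (rule levi_civita_unique[OF _ is_levi_civita_connection])

lemma levi_civita_velocity:
  assumes "smooth_curve A \<omega> I F" "t \<in> I"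
  shows "levi_civita A \<omega> chi I F (velocity F) t = covariant F (velocity F) t"
  using assms smooth_field_velocity[OF assms(1)] by (simp add: levi_civita_eq_connection connection_def)

end

theorem proposition4p11:
  fixes A :: "('a::t2_space, 'n::finite) chart set"
    and \<omega> :: "('a, 'n) two_form"
    and chi :: "real \<Rightarrow> real"
    and I :: "real set"
    and F :: "real \<Rightarrow> 'a \<Rightarrow> real"
  assumes "kaehler_manifold A \<omega>"
    and "compact (UNIV :: 'a set)"
    and "connected (UNIV :: 'a set)"
    and "C_infty_on {0<..} chi"
    and "\<And>r. r > 0 \<Longrightarrow> chi r > 0"
    and "smooth_curve A \<omega> I F"
  shows "\<forall>t\<in>I. levi_civita A \<omega> chi I F (velocity F) t = (\<lambda>_. 0) \<longleftrightarrow>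
    (\<forall>x. velocity (velocity F) t x
       + deriv chi (F t x) / (2 * chi (F t x)) * (velocity F t x)\<^sup>2
       - (1 / chi (F t x)) / integral_vol A \<omega> (\<lambda>y. 1 / chi (F t y))
         * integral_vol A \<omega> (\<lambda>y. deriv chi (F t y) / (2 * chi (F t y)) * (velocity F t y)\<^sup>2) = 0)"
proof
  fix t assume t: "t \<in> I"
  interpret weighted_kaehler A \<omega> chi
    by unfold_locales (use assms in auto)
  show "levi_civita A \<omega> chi I F (velocity F) t = (\<lambda>_. 0) \<longleftrightarrow>
    (\<forall>x. velocity (velocity F) t x
       + deriv chi (F t x) / (2 * chi (F t x)) * (velocity F t x)\<^sup>2
       - (1 / chi (F t x)) / integral_vol A \<omega> (\<lambda>y. 1 / chi (F t y))
         * integral_vol A \<omega> (\<lambda>y. deriv chi (F t y) / (2 * chi (F t y)) * (velocity F t y)\<^sup>2) = 0)"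
    unfolding levi_civita_velocity[OF assms(6) t] fun_eq_iff
    by (simp add: covariant_def multiplier_def christoffel_def[abs_def] slope_def power2_eq_square mult.assoc)
qed

end
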